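(* The Stein group $F_{2,3}$ does not embed in Thompson's group $V$; that is, there is no injective group homomorphism $F_{2,3}\to V$.
   Context: The Stein group $F_{2,3}$ is the group of all piecewise-linear (with finitely many pieces) orientation-preserving homeomorphisms of $[0,1]$ with breakpoints in $\mathbb{Z}[1/6]$ and slopes of the form $2^m3^n$ ($m,n\in\mathbb{Z}$). Thompson's group $V$ is the group of all homeomorphisms $h$ of $\mathfrak{C}=\{0,1\}^{\mathbb{N}}$ (acting on the right) such that for every $\kappa\in\mathfrak{C}$ there exist a finite prefix $w$ of $\kappa$ and a finite string $u$ over $\{0,1\}$ with $(w\kappa')h=u\kappa'$ for all $\kappa'\in\mathfrak{C}$. *)

theory Defs
  imports
    "HOL-Analysis.Analysis"
    "HOL-Algebra.Group"
    "HOL-Library.Omega_Words_Fun"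
begin

text \<open>
  Maps act on the right in both groups: the product of \<open>f\<close> and \<open>g\<close> is ``first \<open>f\<close>, then \<open>g\<close>''.
\<close>

section \<open>The Stein group\<close>

text \<open>The ring $\mathbb{Z}[1/6]$, as a subset of the reals.\<close>

definition Z_inv6 :: "real set" where
  "Z_inv6 = {real_of_int a / 6 ^ k | a k. True}"

definition slopes23 :: "real set" where
  "slopes23 = {2 powi m * 3 powi n | m n. True}"

text \<open>
  The set \<open>B\<close> contains every breakpoint of \<open>f\<close>. It may contain further points, at which
  the slope does not change; the smallest possible \<open>B\<close> is the set of breakpoints.
\<close>

definition piecewise_linear23 :: "(real \<Rightarrow> real) \<Rightarrow> bool" where
  "piecewise_linear23 f \<longleftrightarrow>
     (\<exists>B. finite B \<and> B \<subseteq> Z_inv6 \<and>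
        (\<forall>a b. 0 \<le> a \<and> a < b \<and> b \<le> 1 \<and> {a<..<b} \<inter> B = {} \<longrightarrow>
           (\<exists>s\<in>slopes23. \<exists>c. \<forall>x\<in>{a..b}. f x = s * x + c)))"

text \<open>
  Functions are required to be \<open>extensional\<close> so that each homeomorphism of the unit interval is
  represented by exactly one element of type \<open>real \<Rightarrow> real\<close>.
\<close>

definition stein_F23 :: "(real \<Rightarrow> real) monoid" where
  "stein_F23 =
     \<lparr>carrier = {f \<in> extensional {0..1}.
        homeomorphic_map (top_of_set {0..1}) (top_of_set {0..1}) f \<and>
        strict_mono_on {0..1} f \<and> piecewise_linear23 f},
      mult = (\<lambda>f g. compose {0..1} g f),
      one = (\<lambda>x\<in>{0..1}. x)\<rparr>"


section \<open>Thompson's group V\<close>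

text \<open>
  Cantor space is the type \<open>bool word = nat \<Rightarrow> bool\<close> with its product topology; \<open>w \<frown> x\<close> is the
  concatenation of a finite string \<open>w\<close> and an infinite string \<open>x\<close>.
\<close>

definition thompson_V :: "(bool word \<Rightarrow> bool word) monoid" where
  "thompson_V =
     \<lparr>carrier = {h. homeomorphic_map euclidean euclidean h \<and>
        (\<forall>\<kappa>. \<exists>w u. (\<exists>x. \<kappa> = w \<frown> x) \<and> (\<forall>x. h (w \<frown> x) = u \<frown> x))},
      mult = (\<lambda>f g. g \<circ> f),
      one = id\<rparr>"


section \<open>Both are groups\<close>

lemma conc_inject: "w \<frown> x = w \<frown> y \<Longrightarrow> x = y"
proof
  fix n assume "w \<frown> x = w \<frown> y"
  then have "(w \<frown> x) (length w + n) = (w \<frown> y) (length w + n)" by simp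
  then show "x n = y n" by simp
qed

lemma conc_eq_conc:
  assumes "u \<frown> x = w \<frown> y"
  shows "(\<exists>v. w = u @ v \<and> x = v \<frown> y) \<or> (\<exists>v. u = w @ v \<and> y = v \<frown> x)"
proof -
  have nth: "u ! i = w ! i" if "i < length u" "i < length w" for i
    using fun_cong[OF assms, of i] that by simp
  show ?thesis
  proof (cases "length u \<le> length w")
    case True
    then have "take (length u) w = u" by (intro nth_equalityI) (auto simp: nth)
    then have w: "w = u @ drop (length u) w" by (metis append_take_drop_id)
    have "x = drop (length u) w \<frown> y"
      by (rule conc_inject[of u]) (use assms w in \<open>metis conc_conc\<close>)
    with w show ?thesis by blast
  next
    case False
    then have "take (length w) u = w" by (intro nth_equalityI) (auto simp: nth)
    then have u: "u = w @ drop (length w) u" by (metis append_take_drop_id)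
    have "y = drop (length w) u \<frown> x"
      by (rule conc_inject[of w]) (use assms u in \<open>metis conc_conc\<close>)
    with u show ?thesis by blast
  qed
qed

lemma thompson_V_comp:
  assumes "f \<in> carrier thompson_V" "g \<in> carrier thompson_V"
  shows "g \<circ> f \<in> carrier thompson_V"
proof -
  have "\<exists>w u. (\<exists>x. \<kappa> = w \<frown> x) \<and> (\<forall>x. (g \<circ> f) (w \<frown> x) = u \<frown> x)" for \<kappa>
  proof -
    obtain w u x where f: "\<kappa> = w \<frown> x" "\<And>x. f (w \<frown> x) = u \<frown> x"
      using assms(1) unfolding thompson_V_def by fastforce
    obtain w' u' y where g: "u \<frown> x = w' \<frown> y" "\<And>x. g (w' \<frown> x) = u' \<frown> x"
      using assms(2) unfolding thompson_V_def by simp metis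
    from conc_eq_conc[OF g(1)] show ?thesis
    proof (elim disjE exE conjE)
      fix v assume v: "w' = u @ v" "x = v \<frown> y"
      have "(g \<circ> f) ((w @ v) \<frown> z) = u' \<frown> z" for z
        using f(2)[of "v \<frown> z"] g(2)[of z] v(1) by simp
      moreover have "\<kappa> = (w @ v) \<frown> y" using f(1) v(2) by simp
      ultimately show ?thesis by blast
    next
      fix v assume v: "u = w' @ v" "y = v \<frown> x"
      have "(g \<circ> f) (w \<frown> z) = (u' @ v) \<frown> z" for z
        using f(2)[of z] g(2)[of "v \<frown> z"] v(1) by simp
      with f(1) show ?thesis by blast
    qed
  qed
  moreover have "homeomorphic_map euclidean euclidean (g \<circ> f)"
    using assms homeomorphic_map_compose unfolding thompson_V_def by fastforce
  ultimately show ?thesis by (simp add: thompson_V_def)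
qed

lemma thompson_V_inv:
  assumes "f \<in> carrier thompson_V"
  shows "\<exists>g\<in>carrier thompson_V. f \<circ> g = id"
proof -
  obtain g where fg: "homeomorphic_maps euclidean euclidean f g"
    using assms by (auto simp: thompson_V_def homeomorphic_map_maps)
  then have inv: "g (f x) = x" "f (g x) = x" for x by (auto simp: homeomorphic_maps_def)
  have "\<exists>w u. (\<exists>x. \<kappa> = w \<frown> x) \<and> (\<forall>x. g (w \<frown> x) = u \<frown> x)" for \<kappa>
  proof -
    obtain w u x where f: "g \<kappa> = w \<frown> x" "\<And>x. f (w \<frown> x) = u \<frown> x"
      using assms unfolding thompson_V_def by simp metis
    have "\<kappa> = u \<frown> x" using f inv by metis
    moreover have "g (u \<frown> z) = w \<frown> z" for z using f inv by metis
    ultimately show ?thesis by blast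
  qed
  moreover have "homeomorphic_map euclidean euclidean g"
    using fg homeomorphic_map_maps homeomorphic_maps_sym by blast
  ultimately have "g \<in> carrier thompson_V" by (simp add: thompson_V_def)
  with inv show ?thesis by (auto simp: fun_eq_iff)
qed

theorem group_thompson_V: "group thompson_V"
proof (rule groupI)
  show "\<one>\<^bsub>thompson_V\<^esub> \<in> carrier thompson_V"
    using homeomorphic_map_id[of euclidean euclidean]
    by (auto simp: thompson_V_def intro!: exI[of _ "[]"])
qed (use thompson_V_comp thompson_V_inv in \<open>auto simp: thompson_V_def comp_assoc\<close>)

lemma Z_inv6_0 [simp]: "0 \<in> Z_inv6" and Z_inv6_1 [simp]: "1 \<in> Z_inv6"
  unfolding Z_inv6_def by (auto intro: exI[of _ "0::int"] exI[of _ "1::int"] exI[of _ "0::nat"])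

lemma Z_inv6_add: "x + y \<in> Z_inv6" if *: "x \<in> Z_inv6" "y \<in> Z_inv6"
proof -
  obtain a k b l where "x = of_int a / 6 ^ k" "y = of_int b / 6 ^ l"
    using * unfolding Z_inv6_def by blast
  then have "x + y = of_int (a * 6 ^ l + b * 6 ^ k) / 6 ^ (k + l)"
    by (simp add: add_divide_distrib power_add)
  then show ?thesis unfolding Z_inv6_def by blast
qed

lemma Z_inv6_mult: "x * y \<in> Z_inv6" if *: "x \<in> Z_inv6" "y \<in> Z_inv6"
proof -
  obtain a k b l where "x = of_int a / 6 ^ k" "y = of_int b / 6 ^ l"
    using * unfolding Z_inv6_def by blast
  then have "x * y = of_int (a * b) / 6 ^ (k + l)"
    by (simp add: power_add)
  then show ?thesis unfolding Z_inv6_def by blast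
qed

lemma Z_inv6_of_int: "of_int a \<in> Z_inv6"
  unfolding Z_inv6_def by (auto intro!: exI[of _ a] exI[of _ "0::nat"])

lemma Z_inv6_diff: "x - y \<in> Z_inv6" if "x \<in> Z_inv6" "y \<in> Z_inv6"
  using Z_inv6_add[OF that(1) Z_inv6_mult[OF Z_inv6_of_int[of "-1"] that(2)]] by simp

lemma Z_inv6_power: "x ^ n \<in> Z_inv6" if "x \<in> Z_inv6"
  by (induction n) (auto intro: Z_inv6_mult that)

lemma slopes23_subset: "slopes23 \<subseteq> Z_inv6"
proof -
  have "inverse 2 = of_int 3 / (6::real) ^ 1" "inverse 3 = of_int 2 / (6::real) ^ 1" by simp_all
  then have "inverse 2 \<in> Z_inv6" "inverse 3 \<in> Z_inv6" unfolding Z_inv6_def by blast+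
  moreover have "2 \<in> Z_inv6" "3 \<in> Z_inv6" using Z_inv6_of_int[of 2] Z_inv6_of_int[of 3] by simp_all
  ultimately show ?thesis
    by (auto simp: slopes23_def power_int_def intro!: Z_inv6_mult Z_inv6_power)
qed

lemma slopes23_pos: "s > 0" if "s \<in> slopes23"
  using that by (auto simp: slopes23_def)

lemma slopes23_1: "1 \<in> slopes23"
  unfolding slopes23_def by (auto intro!: exI[of _ "0::int"])

lemma slopes23_mult: "s * t \<in> slopes23" if *: "s \<in> slopes23" "t \<in> slopes23"
proof -
  obtain m n k l where "s = 2 powi m * 3 powi n" "t = 2 powi k * 3 powi l"
    using * unfolding slopes23_def by blast
  then have "s * t = 2 powi (m + k) * 3 powi (n + l)" by (simp add: power_int_add)
  then show ?thesis unfolding slopes23_def by blast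
qed

lemma slopes23_inverse: "inverse s \<in> slopes23" if *: "s \<in> slopes23"
proof -
  obtain m n where "s = 2 powi m * 3 powi n" using * unfolding slopes23_def by blast
  then have "inverse s = 2 powi (- m) * 3 powi (- n)" by (simp add: power_int_minus)
  then show ?thesis unfolding slopes23_def by blast
qed

lemma stein_F23_bij:
  assumes "f \<in> carrier stein_F23"
  shows "bij_betw f {0..1} {0..1}"
  using assms homeomorphic_imp_surjective_map[of "top_of_set {0..1}" "top_of_set {0..1}" f]
    homeomorphic_imp_injective_map[of "top_of_set {0..1}" "top_of_set {0..1}" f]
  by (auto simp: stein_F23_def bij_betw_def)

lemma stein_F23_less_iff:
  assumes "f \<in> carrier stein_F23" "x \<in> {0..1}" "y \<in> {0..1}"
  shows "f x < f y \<longleftrightarrow> x < y"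
  using assms strict_mono_on_less[of "{0..1}" f x y] by (simp add: stein_F23_def)

lemma stein_F23_0:
  assumes "f \<in> carrier stein_F23"
  shows "f 0 = 0"
proof -
  have im: "f ` {0..1} = {0..1}" using stein_F23_bij[OF assms] by (simp add: bij_betw_def)
  then obtain x where x: "x \<in> {0..1}" "f x = 0" by (metis atLeastAtMost_iff imageE order_refl zero_le_one)
  have "f 0 \<in> {0..1}" using im by auto
  then have "\<not> 0 < x" using stein_F23_less_iff[OF assms, of 0 x] x by auto
  with x show ?thesis by auto
qed

lemma stein_F23_Z_inv6_iff:
  assumes f: "f \<in> carrier stein_F23" and x: "x \<in> {0..1}"
  shows "f x \<in> Z_inv6 \<longleftrightarrow> x \<in> Z_inv6"
proof -
  obtain B where B: "finite B" "B \<subseteq> Z_inv6"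
    "\<And>a b. 0 \<le> a \<Longrightarrow> a < b \<Longrightarrow> b \<le> 1 \<Longrightarrow> {a<..<b} \<inter> B = {} \<Longrightarrow>
       \<exists>s\<in>slopes23. \<exists>c. \<forall>x\<in>{a..b}. f x = s * x + c"
    using f by (auto simp: stein_F23_def piecewise_linear23_def)
  show ?thesis using x
  proof (induction "card (B \<inter> {..<x})" arbitrary: x rule: less_induct)
    case less
    define C where "C = insert 0 (B \<inter> {0<..<x})"
    show ?case
    proof (cases "x = 0")
      case True
      then show ?thesis by (simp add: stein_F23_0[OF f])
    next
      case False
      define y where "y = Max C"
      have fin: "finite C" using B(1) by (simp add: C_def)
      have "y \<in> C" unfolding y_def using fin by (rule Max_in) (simp add: C_def)
      then have y: "0 \<le> y" "y < x" "y \<in> Z_inv6" "y = 0 \<or> y \<in> B"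
        using False less.prems B(2) by (auto simp: C_def)
      have "{y<..<x} \<inter> B = {}"
      proof (rule ccontr)
        assume "{y<..<x} \<inter> B \<noteq> {}"
        then obtain z where "z \<in> B" "y < z" "z < x" by auto
        with y(1) have "z \<in> C" by (simp add: C_def)
        then have "z \<le> y" unfolding y_def using fin by simp
        with \<open>y < z\<close> show False by simp
      qed
      then obtain s c where s: "s \<in> slopes23" "\<And>z. z \<in> {y..x} \<Longrightarrow> f z = s * z + c"
        using B(3)[of y x] y less.prems by auto
      have sZ: "s \<in> Z_inv6" "inverse s \<in> Z_inv6"
        using s(1) slopes23_inverse slopes23_subset by auto
      have fy: "f y \<in> Z_inv6"
      proof (cases "y = 0")
        case True
        then show ?thesis by (simp add: stein_F23_0[OF f])
      next
        case False
        then have "B \<inter> {..<y} \<subset> B \<inter> {..<x}" using y by auto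
        then have "card (B \<inter> {..<y}) < card (B \<inter> {..<x})" using B(1) by (simp add: psubset_card_mono)
        then show ?thesis using less.hyps[of y] y less.prems by auto
      qed
      have fx: "f x = f y + s * (x - y)" using s(2)[of x] s(2)[of y] y by (simp add: algebra_simps)
      then have "x = y + inverse s * (f x - f y)" using slopes23_pos[OF s(1)] by (simp add: field_simps)
      with fx show ?thesis using y(3) fy sZ by (metis Z_inv6_add Z_inv6_diff Z_inv6_mult)
    qed
  qed
qed

lemma stein_F23_comp:
  assumes f: "f \<in> carrier stein_F23" and g: "g \<in> carrier stein_F23"
  shows "compose {0..1} g f \<in> carrier stein_F23"
proof -
  have f_in: "f x \<in> {0..1}" if "x \<in> {0..1}" for x
    using stein_F23_bij[OF f] that by (auto simp: bij_betw_def)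
  have eq: "compose {0..1} g f x = g (f x)" if "x \<in> {0..1}" for x
    using that by (simp add: compose_def)
  obtain B where B: "finite B" "B \<subseteq> Z_inv6"
    "\<And>a b. 0 \<le> a \<Longrightarrow> a < b \<Longrightarrow> b \<le> 1 \<Longrightarrow> {a<..<b} \<inter> B = {} \<Longrightarrow>
       \<exists>s\<in>slopes23. \<exists>c. \<forall>x\<in>{a..b}. f x = s * x + c"
    using f by (auto simp: stein_F23_def piecewise_linear23_def)
  obtain C where C: "finite C" "C \<subseteq> Z_inv6"
    "\<And>a b. 0 \<le> a \<Longrightarrow> a < b \<Longrightarrow> b \<le> 1 \<Longrightarrow> {a<..<b} \<inter> C = {} \<Longrightarrow>
       \<exists>s\<in>slopes23. \<exists>c. \<forall>x\<in>{a..b}. g x = s * x + c"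
    using g by (auto simp: stein_F23_def piecewise_linear23_def)
  define D where "D = B \<union> (f -` C \<inter> {0..1})"
  have "piecewise_linear23 (compose {0..1} g f)"
    unfolding piecewise_linear23_def
  proof (intro exI[of _ D] conjI allI impI)
    show "finite D"
      using stein_F23_bij[OF f] by (simp add: D_def B(1) C(1) bij_betw_def finite_vimage_IntI)
    show "D \<subseteq> Z_inv6"
      using B(2) C(2) stein_F23_Z_inv6_iff[OF f] by (auto simp: D_def)
  next
    fix a b :: real
    assume ab: "0 \<le> a \<and> a < b \<and> b \<le> 1 \<and> {a<..<b} \<inter> D = {}"
    then have "{a<..<b} \<inter> B = {}" by (auto simp: D_def)
    then obtain s c where s: "s \<in> slopes23" "\<And>x. x \<in> {a..b} \<Longrightarrow> f x = s * x + c"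
      using B(3)[of a b] ab by auto
    have "{f a<..<f b} \<inter> C = {}"
    proof (rule ccontr)
      assume "{f a<..<f b} \<inter> C \<noteq> {}"
      then obtain y where y: "y \<in> C" "f a < y" "y < f b" by auto
      moreover have "f a \<in> {0..1}" "f b \<in> {0..1}" using f_in ab by auto
      ultimately have "y \<in> f ` {0..1}" using stein_F23_bij[OF f] by (simp add: bij_betw_def)
      then obtain x where x: "x \<in> {0..1}" "y = f x" by blast
      then have "a < x" "x < b"
        using y ab stein_F23_less_iff[OF f, of a x] stein_F23_less_iff[OF f, of x b] by auto
      with x y(1) ab show False by (auto simp: D_def)
    qed
    moreover have "0 \<le> f a" "f a < f b" "f b \<le> 1"
      using f_in[of a] f_in[of b] stein_F23_less_iff[OF f, of a b] ab by auto
    ultimately obtain t d where t: "t \<in> slopes23" "\<And>y. y \<in> {f a..f b} \<Longrightarrow> g y = t * y + d"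
      using C(3)[of "f a" "f b"] by auto
    have "compose {0..1} g f x = t * s * x + (t * c + d)" if x: "x \<in> {a..b}" for x
    proof -
      have "f x \<in> {f a..f b}" using x ab s slopes23_pos[OF s(1)] by auto
      then show ?thesis using t(2) s(2)[OF x] x ab eq[of x] by (simp add: algebra_simps)
    qed
    with slopes23_mult[OF t(1) s(1)]
    show "\<exists>s\<in>slopes23. \<exists>c. \<forall>x\<in>{a..b}. compose {0..1} g f x = s * x + c" by blast
  qed
  moreover have "homeomorphic_map (top_of_set {0..1}) (top_of_set {0..1}) (compose {0..1} g f)"
  proof (rule homeomorphic_map_eq)
    show "homeomorphic_map (top_of_set {0..1}) (top_of_set {0..1}) (g \<circ> f)"
      using f g homeomorphic_map_compose by (auto simp: stein_F23_def)
  qed (simp add: eq)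
  moreover have "strict_mono_on {0..1} (compose {0..1} g f)"
    using stein_F23_less_iff[OF f] stein_F23_less_iff[OF g] f_in
    by (auto simp: strict_mono_on_def compose_def)
  ultimately show ?thesis by (simp add: stein_F23_def)
qed

lemma stein_F23_inv:
  assumes f: "f \<in> carrier stein_F23"
  shows "\<exists>g\<in>carrier stein_F23. compose {0..1} f g = (\<lambda>x\<in>{0..1}. x)"
proof -
  obtain g' where fg': "homeomorphic_maps (top_of_set {0..1}) (top_of_set {0..1}) f g'"
    using f by (auto simp: stein_F23_def homeomorphic_map_maps)
  define g where "g = restrict g' {0..1}"
  have fg: "homeomorphic_maps (top_of_set {0..1}) (top_of_set {0..1}) f g"
    by (rule homeomorphic_maps_eq[OF fg']) (auto simp: g_def)
  have f_in: "f x \<in> {0..1}" if "x \<in> {0..1}" for x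
    using stein_F23_bij[OF f] that by (auto simp: bij_betw_def)
  have inv: "g (f x) = x" "f (g x) = x" if "x \<in> {0..1}" for x
    using fg that by (auto simp: homeomorphic_maps_def)
  have g_in: "g x \<in> {0..1}" if "x \<in> {0..1}" for x
    using inv(1) that stein_F23_bij[OF f] by (metis bij_betw_def imageE)
  have mono: "g x < g y \<longleftrightarrow> x < y" if "x \<in> {0..1}" "y \<in> {0..1}" for x y
    using stein_F23_less_iff[OF f, of "g x" "g y"] g_in inv that by simp
  obtain B where B: "finite B" "B \<subseteq> Z_inv6"
    "\<And>a b. 0 \<le> a \<Longrightarrow> a < b \<Longrightarrow> b \<le> 1 \<Longrightarrow> {a<..<b} \<inter> B = {} \<Longrightarrow>
       \<exists>s\<in>slopes23. \<exists>c. \<forall>x\<in>{a..b}. f x = s * x + c"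
    using f by (auto simp: stein_F23_def piecewise_linear23_def)
  have "piecewise_linear23 g"
    unfolding piecewise_linear23_def
  proof (intro exI[of _ "f ` (B \<inter> {0..1})"] conjI allI impI)
    show "f ` (B \<inter> {0..1}) \<subseteq> Z_inv6"
      using B(2) stein_F23_Z_inv6_iff[OF f] by auto
  next
    fix a b :: real
    assume ab: "0 \<le> a \<and> a < b \<and> b \<le> 1 \<and> {a<..<b} \<inter> f ` (B \<inter> {0..1}) = {}"
    then have in01: "a \<in> {0..1}" "b \<in> {0..1}" by auto
    have "{g a<..<g b} \<inter> B = {}"
    proof (rule ccontr)
      assume "{g a<..<g b} \<inter> B \<noteq> {}"
      then obtain x where x: "x \<in> B" "g a < x" "x < g b" by auto
      then have "x \<in> {0..1}" using g_in[OF in01(1)] g_in[OF in01(2)] by auto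
      moreover have "a < f x" "f x < b"
        using x mono[OF in01(1) f_in] mono[OF f_in in01(2)] calculation inv by auto
      ultimately show False using x(1) ab by auto
    qed
    moreover have "0 \<le> g a" "g a < g b" "g b \<le> 1"
      using g_in[OF in01(1)] g_in[OF in01(2)] mono[OF in01] ab by auto
    ultimately obtain s c where s: "s \<in> slopes23" "\<And>x. x \<in> {g a..g b} \<Longrightarrow> f x = s * x + c"
      using B(3)[of "g a" "g b"] by auto
    have "g y = inverse s * y + (- c / s)" if y: "y \<in> {a..b}" for y
    proof -
      have y01: "y \<in> {0..1}" using y ab by auto
      have "g y \<in> {g a..g b}" using mono[OF y01 in01(1)] mono[OF in01(2) y01] y by auto
      then have "y = s * g y + c" using s(2) inv(2)[OF y01] by metis
      then show ?thesis using slopes23_pos[OF s(1)] by (simp add: field_simps)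
    qed
    with slopes23_inverse[OF s(1)]
    show "\<exists>s\<in>slopes23. \<exists>c. \<forall>x\<in>{a..b}. g x = s * x + c" by blast
  qed (simp add: B(1))
  moreover have "homeomorphic_map (top_of_set {0..1}) (top_of_set {0..1}) g"
    using fg homeomorphic_map_maps homeomorphic_maps_sym by blast
  moreover have "strict_mono_on {0..1} g" using mono by (auto simp: strict_mono_on_def)
  ultimately have "g \<in> carrier stein_F23" by (simp add: stein_F23_def g_def)
  moreover have "compose {0..1} f g = (\<lambda>x\<in>{0..1}. x)"
    using inv by (auto simp: compose_def fun_eq_iff)
  ultimately show ?thesis by blast
qed

lemma stein_F23_id: "(\<lambda>x\<in>{0..1}. x) \<in> carrier stein_F23"
proof -
  have "homeomorphic_map (top_of_set {0..1}) (top_of_set {0..1}) (\<lambda>x\<in>{0..1::real}. x)"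
    by (rule homeomorphic_map_eq[of _ _ id]) auto
  moreover have "piecewise_linear23 (\<lambda>x\<in>{0..1}. x)"
    unfolding piecewise_linear23_def
    by (intro exI[of _ "{}"]) (auto intro!: bexI[OF _ slopes23_1] exI[of _ "0::real"])
  ultimately show ?thesis by (auto simp: stein_F23_def strict_mono_on_def)
qed

theorem group_stein_F23: "group stein_F23"
proof (rule groupI)
  fix f g h
  assume *: "f \<in> carrier stein_F23" "g \<in> carrier stein_F23" "h \<in> carrier stein_F23"
  then have "f \<in> {0..1} \<rightarrow> {0..1}" using stein_F23_bij bij_betw_imp_funcset by blast
  then show "f \<otimes>\<^bsub>stein_F23\<^esub> g \<otimes>\<^bsub>stein_F23\<^esub> h = f \<otimes>\<^bsub>stein_F23\<^esub> (g \<otimes>\<^bsub>stein_F23\<^esub> h)"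
    by (auto simp: stein_F23_def compose_def fun_eq_iff)
next
  fix f
  assume *: "f \<in> carrier stein_F23"
  then have "f \<in> extensional {0..1}" by (simp add: stein_F23_def)
  then show "\<one>\<^bsub>stein_F23\<^esub> \<otimes>\<^bsub>stein_F23\<^esub> f = f"
    by (auto simp: stein_F23_def compose_def fun_eq_iff extensional_def)
  show "\<exists>g\<in>carrier stein_F23. g \<otimes>\<^bsub>stein_F23\<^esub> f = \<one>\<^bsub>stein_F23\<^esub>"
    using stein_F23_inv[OF *] by (simp add: stein_F23_def)
qed (use stein_F23_comp stein_F23_id in \<open>simp_all add: stein_F23_def\<close>)

end

theory Submission
  imports Defs
begin

text \<open>
  Germs at a fixed point of an element of \<open>V\<close> form a cyclic group, so two commuting
  elements of \<open>V\<close> fixing a point satisfy a nontrivial multiplicative relation near it. Near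
  \<open>0\<close>, however, the slopes \<open>2\<close> and \<open>3\<close> realised in $F_{2,3}$ are multiplicatively independent.

  Call a fixed point of \<open>h\<close> essential if \<open>h\<close> is not the identity near it. The essential
  fixed points of \<open>h \<in> V\<close> form a finite set, which the centralizer of \<open>h\<close> permutes, and
  suitable commutators in the centralizer are the identity near it. Let \<open>a\<close> and \<open>b\<close> act
  near \<open>0\<close> as division by \<open>2\<close> and by \<open>3\<close>, let \<open>h\<close> be a commutator of elements with small
  support near \<open>0\<close>, and let \<open>P\<close> be the set of essential fixed points of a power of the image
  of \<open>h\<close>. Conjugates of \<open>h\<close> with disjoint supports commute, so \<open>P\<close> and its translate by
  $a^m b^n$ are disjoint as soon as $2^m 3^n \ge 2$. On the other hand $a^m P$ accumulates,
  as \<open>m\<close> grows, at a point that is periodic for both \<open>a\<close> and \<open>b\<close>; the relation between their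
  germs there makes two such translates meet.
\<close>

section \<open>Words and local maps\<close>

lemma eventually_nhds_word_iff:
  fixes p :: "bool word"
  shows "eventually P (nhds p) \<longleftrightarrow> (\<exists>n. \<forall>x. P (prefix n p \<frown> x))"
proof
  assume "eventually P (nhds p)"
  then obtain S where S: "open S" "p \<in> S" "\<And>x. x \<in> S \<Longrightarrow> P x"
    unfolding eventually_nhds by blast
  from S(1) have "openin (product_topology (\<lambda>_. euclidean) UNIV) S" by (simp add: open_fun_def)
  from product_topology_open_contains_basis[OF this S(2)]
  obtain X where X: "p \<in> Pi\<^sub>E UNIV X" "finite {i. X i \<noteq> UNIV}" "Pi\<^sub>E UNIV X \<subseteq> S" by auto
  define n where "n = Suc (Max (insert 0 {i. X i \<noteq> UNIV}))"
  have n: "X i = UNIV" if "i \<ge> n" for i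
  proof (rule ccontr)
    assume "X i \<noteq> UNIV"
    then have "i \<le> Max (insert 0 {i. X i \<noteq> UNIV})" using X(2) by simp
    with that show False by (simp add: n_def)
  qed
  have "P (prefix n p \<frown> x)" for x
  proof -
    have "(prefix n p \<frown> x) i \<in> X i" for i
      using X(1) n[of i] by (cases "i < n") (auto simp: PiE_iff)
    then show ?thesis using S(3) X(3) by (auto simp: PiE_iff)
  qed
  then show "\<exists>n. \<forall>x. P (prefix n p \<frown> x)" by blast
next
  assume "\<exists>n. \<forall>x. P (prefix n p \<frown> x)"
  then obtain n where n: "\<And>x. P (prefix n p \<frown> x)" by blast
  have "open ((\<lambda>x::bool word. x i) -` {p i})" for i
    by (rule open_vimage[OF open_discrete]) (simp add: continuous_on_product_coordinates)
  then have "open (\<Inter>i\<in>{..<n}. (\<lambda>x::bool word. x i) -` {p i})" by (intro open_INT) auto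
  then have "open {x. \<forall>i\<in>{..<n}. x i = p i}" by (simp add: vimage_def INTER_eq)
  moreover have "P x" if "\<forall>i\<in>{..<n}. x i = p i" for x
  proof -
    have "prefix n x = prefix n p" using that by (intro nth_equalityI) auto
    then show ?thesis using n[of "suffix n x"] by (metis prefix_suffix)
  qed
  ultimately show "eventually P (nhds p)" unfolding eventually_nhds by auto
qed

lemma word_limit_iff:
  fixes X :: "nat \<Rightarrow> bool word"
  shows "X \<longlonglongrightarrow> q \<longleftrightarrow> (\<forall>l. \<forall>\<^sub>F j in sequentially. prefix l (X j) = prefix l q)"
proof
  assume X: "X \<longlonglongrightarrow> q"
  show "\<forall>l. \<forall>\<^sub>F j in sequentially. prefix l (X j) = prefix l q"
  proof
    fix l
    have "\<forall>\<^sub>F x in nhds q. prefix l x = prefix l q"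
      unfolding eventually_nhds_word_iff by (intro exI[of _ l]) simp
    with X show "\<forall>\<^sub>F j in sequentially. prefix l (X j) = prefix l q"
      using filterlim_iff by fastforce
  qed
next
  assume *: "\<forall>l. \<forall>\<^sub>F j in sequentially. prefix l (X j) = prefix l q"
  show "X \<longlonglongrightarrow> q"
    unfolding filterlim_iff
  proof (intro allI impI)
    fix P assume "eventually P (nhds q)"
    then obtain n where n: "\<And>x. P (prefix n q \<frown> x)" unfolding eventually_nhds_word_iff by blast
    have "P x" if "prefix n x = prefix n q" for x using n[of "suffix n x"] that by (metis prefix_suffix)
    then show "\<forall>\<^sub>F j in sequentially. P (X j)"
      using *[rule_format, of n] by (auto elim: eventually_mono)
  qed
qed

text \<open>Compactness of Cantor space in the form of Koenig's lemma: if no depth sufficed, an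
  infinite branch of \<open>bad\<close> words would contradict \<open>ex\<close>.\<close>

lemma word_compactness:
  fixes Q :: "bool list \<Rightarrow> bool"
  assumes ex: "\<And>\<kappa>. \<exists>n. Q (prefix n \<kappa>)" and ext: "\<And>w v. Q w \<Longrightarrow> Q (w @ v)"
  shows "\<exists>N. \<forall>w. N \<le> length w \<longrightarrow> Q w"
proof (rule ccontr)
  define bad where "bad w \<longleftrightarrow> (\<forall>N. \<exists>v. N \<le> length v \<and> \<not> Q (w @ v))" for w
  assume "\<not> ?thesis"
  then have bad0: "bad []" by (auto simp: bad_def)
  have step: "bad (w @ [True]) \<or> bad (w @ [False])" if w: "bad w" for w
  proof (rule ccontr)
    assume "\<not> ?thesis"
    then obtain M N where MN: "\<And>v. M \<le> length v \<Longrightarrow> Q (w @ [True] @ v)"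
      "\<And>v. N \<le> length v \<Longrightarrow> Q (w @ [False] @ v)"
      by (auto simp: bad_def)
    obtain v where v: "Suc (max M N) \<le> length v" "\<not> Q (w @ v)" using w unfolding bad_def by blast
    then obtain b v' where "v = b # v'" by (cases v) auto
    with v MN show False by (cases b) auto
  qed
  define path where "path = rec_nat [] (\<lambda>_ w. w @ [bad (w @ [True])])"
  have path: "path 0 = []" "path (Suc n) = path n @ [bad (path n @ [True])]" for n
    by (simp_all add: path_def)
  have bad: "bad (path n)" for n
  proof (induction n)
    case (Suc n)
    then show ?case using step[of "path n"] by (cases "bad (path n @ [True])") (auto simp: path)
  qed (simp add: path bad0)
  define \<kappa> where "\<kappa> n = path (Suc n) ! n" for n
  have len: "length (path n) = n" for n by (induction n) (auto simp: path)
  have "prefix n \<kappa> = path n" for n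
  proof (induction n)
    case (Suc n)
    have "\<kappa> n = bad (path n @ [True])" by (simp add: \<kappa>_def path nth_append len)
    with Suc show ?case by (simp add: path)
  qed (simp add: path)
  then show False using ex[of \<kappa>] bad ext unfolding bad_def by metis
qed

lemma conc_fixed_unique:
  assumes v: "v \<noteq> []" and x: "x = v \<frown> x" and y: "y = v \<frown> y"
  shows "x = y"
proof
  fix n show "x n = y n"
  proof (induction n rule: less_induct)
    case (less n)
    show ?case
    proof (cases "n < length v")
      case True
      then show ?thesis using fun_cong[OF x, of n] fun_cong[OF y, of n] by simp
    next
      case False
      then have "x (n - length v) = y (n - length v)" using v by (intro less) (cases v, auto)
      then show ?thesis using fun_cong[OF x, of n] fun_cong[OF y, of n] False by simp
    qed
  qed
qed

section \<open>Elements of \<open>V\<close> as homeomorphisms and prefix replacements\<close>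

lemma thompson_V_local:
  assumes "h \<in> carrier thompson_V"
  obtains w u y where "\<kappa> = w \<frown> y" "\<And>x. h (w \<frown> x) = u \<frown> x"
  using assms unfolding thompson_V_def by fastforce

lemma thompson_V_bij: "bij h" if "h \<in> carrier thompson_V"
proof -
  have "homeomorphic_map euclidean euclidean h" using that by (simp add: thompson_V_def)
  then show ?thesis
    using homeomorphic_imp_injective_map homeomorphic_imp_surjective_map
    by (fastforce simp: bij_def)
qed

lemma thompson_V_tendsto: "(h \<longlongrightarrow> h p) (nhds p)" if "h \<in> carrier thompson_V"
proof -
  have "continuous_on UNIV h"
    using that homeomorphic_imp_continuous_map[of euclidean euclidean h] by (simp add: thompson_V_def)
  then have "(h \<longlongrightarrow> h p) (at p)" unfolding continuous_on_def by simp
  then show ?thesis by (simp add: tendsto_at_iff_tendsto_nhds)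
qed

lemma thompson_V_eventually:
  assumes "h \<in> carrier thompson_V" "eventually P (nhds (h p))"
  shows "\<forall>\<^sub>F x in nhds p. P (h x)"
  using thompson_V_tendsto[OF assms(1)] assms(2) unfolding filterlim_iff by blast

lemma thompson_V_inv_into:
  assumes "h \<in> carrier thompson_V"
  shows "inv_into UNIV h \<in> carrier thompson_V"
proof -
  obtain g where g: "g \<in> carrier thompson_V" "h \<circ> g = id" using thompson_V_inv[OF assms] by blast
  have "inv_into UNIV h = g"
  proof
    fix x show "inv_into UNIV h x = g x"
      using fun_cong[OF g(2), of x] thompson_V_bij[OF assms] by (metis bij_inv_eq_iff comp_apply id_apply)
  qed
  with g show ?thesis by simp
qed

lemma thompson_V_inv_apply [simp]:
  assumes "h \<in> carrier thompson_V"
  shows "inv_into UNIV h (h x) = x" "h (inv_into UNIV h x) = x"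
  using thompson_V_bij[OF assms] by (auto simp: bij_def surj_f_inv_f)

lemma thompson_V_id: "id \<in> carrier thompson_V"
  using group.is_monoid[OF group_thompson_V] monoid.one_closed[of thompson_V]
  by (simp add: thompson_V_def)

lemma thompson_V_funpow: "h ^^ n \<in> carrier thompson_V" if "h \<in> carrier thompson_V"
proof (induction n)
  case (Suc n)
  show ?case using thompson_V_comp[OF Suc that] by (simp add: comp_def)
qed (use thompson_V_id in \<open>simp add: id_def\<close>)

text \<open>Prefix replacement is inherited by longer words, so compactness makes one depth
  \<open>N\<close> serve all points. The word \<open>H w\<close> itself may be shorter than
  \<open>N\<close>.\<close>

lemma thompson_V_level:
  assumes h: "h \<in> carrier thompson_V"
  obtains N H where "\<And>w x. N \<le> length w \<Longrightarrow> h (w \<frown> x) = H w \<frown> x"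
proof -
  have "\<exists>N. \<forall>w. N \<le> length w \<longrightarrow> (\<exists>u. \<forall>x. h (w \<frown> x) = u \<frown> x)"
  proof (rule word_compactness)
    fix \<kappa>
    obtain w u y where "\<kappa> = w \<frown> y" "\<And>x. h (w \<frown> x) = u \<frown> x" by (rule thompson_V_local[OF h, of \<kappa>]) (rule that)
    then show "\<exists>n u. \<forall>x. h (prefix n \<kappa> \<frown> x) = u \<frown> x" by (metis prefix_conc_length)
  next
    fix w v assume "\<exists>u. \<forall>x. h (w \<frown> x) = u \<frown> x"
    then show "\<exists>u. \<forall>x. h ((w @ v) \<frown> x) = u \<frown> x" by (metis conc_conc)
  qed
  then show ?thesis using that by metis
qed

section \<open>Essential fixed points and germs\<close>

lemma conc_eq_imp_eq:
  fixes u w :: "bool list"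
  assumes *: "\<And>x. u \<frown> x = w \<frown> x"
  shows "u = w"
proof -
  \<comment> \<open>The constant sequence of the letter opposite to the first one of
    \<open>v\<close> changes when \<open>v\<close> is prepended.\<close>
  have no: False if "v \<noteq> []" "\<And>x. v \<frown> x = x" for v :: "bool list"
    using fun_cong[OF that(2)[of "\<lambda>_. \<not> v ! 0"], of 0] that(1) by simp
  from conc_eq_conc[OF *[of "\<lambda>_. True"]] show ?thesis
  proof (elim disjE exE conjE)
    fix v assume v: "w = u @ v"
    have "v \<frown> x = x" for x using *[of x] v by (metis conc_conc same_concat_eq)
    with no v show ?thesis by (cases "v = []") auto
  next
    fix v assume v: "u = w @ v"
    have "v \<frown> x = x" for x using *[of x] v by (metis conc_conc same_concat_eq)
    with no v show ?thesis by (cases "v = []") auto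
  qed
qed

lemma thompson_V_inj: "inj h" if "h \<in> carrier thompson_V"
  using thompson_V_bij[OF that] by (rule bij_is_inj)

lemma finite_words_length: "finite {w :: bool list. length w = N}"
  using finite_lists_length_eq[of "UNIV :: bool set" N] by simp

lemma finite_words_length_le: "finite {w :: bool list. length w \<le> N}"
  using finite_lists_length_le[of "UNIV :: bool set" N] by simp

definition essential_fixpoints :: "('a::topological_space \<Rightarrow> 'a) \<Rightarrow> 'a set" where
  "essential_fixpoints h = {p. h p = p \<and> \<not> (\<forall>\<^sub>F x in nhds p. h x = x)}"

text \<open>There are finitely many cylinders of depth \<open>N\<close>, and each holds at most one
  essential fixed point: if \<open>h\<close> replaces \<open>w\<close> by a different
  \<open>u\<close>, being fixed forces the tail to be one word repeated for ever.\<close>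

lemma finite_essential_fixpoints:
  assumes h: "h \<in> carrier thompson_V"
  shows "finite (essential_fixpoints h)"
proof -
  obtain N H where H: "\<And>w x. N \<le> length w \<Longrightarrow> h (w \<frown> x) = H w \<frown> x"
    using thompson_V_level[OF h] by blast
  have "inj_on (prefix N) (essential_fixpoints h)"
  proof (rule inj_onI)
    fix p p' assume p: "p \<in> essential_fixpoints h" and p': "p' \<in> essential_fixpoints h"
      and eq: "prefix N p = prefix N p'"
    define w where "w = prefix N p"
    define x where "x = suffix N p"
    define x' where "x' = suffix N p'"
    define u where "u = H w"
    have px: "p = w \<frown> x"
      unfolding w_def x_def by (rule prefix_suffix)
    have px': "p' = w \<frown> x'"
      unfolding w_def x'_def eq by (rule prefix_suffix)
    have hw: "h (w \<frown> z) = u \<frown> z" for z using H[of w z] by (simp add: w_def u_def)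
    have fixed: "u \<frown> x = w \<frown> x" "u \<frown> x' = w \<frown> x'"
      using p p' px px' hw by (auto simp: essential_fixpoints_def)
    have ne: "u \<noteq> w"
    proof
      assume "u = w"
      then have "\<forall>\<^sub>F z in nhds p. h z = z"
        unfolding eventually_nhds_word_iff using hw by (intro exI[of _ N]) (simp add: w_def)
      with p show False by (simp add: essential_fixpoints_def)
    qed
    have "x = x'"
      using conc_eq_conc[OF fixed(1)]
    proof (elim disjE exE conjE)
      fix v assume v: "w = u @ v" "x = v \<frown> x"
      then have "x' = v \<frown> x'" using fixed(2) by (metis conc_conc same_concat_eq)
      moreover have "v \<noteq> []" using v(1) ne by auto
      ultimately show ?thesis using v(2) by (metis conc_fixed_unique)
    next
      fix v assume v: "u = w @ v" "x = v \<frown> x"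
      then have "x' = v \<frown> x'" using fixed(2) by (metis conc_conc same_concat_eq)
      moreover have "v \<noteq> []" using v(1) ne by auto
      ultimately show ?thesis using v(2) by (metis conc_fixed_unique)
    qed
    with px px' show "p = p'" by simp
  qed
  moreover have "finite (prefix N ` essential_fixpoints h)"
    by (rule finite_subset[OF _ finite_words_length[of N]]) auto
  ultimately show ?thesis by (rule finite_imageD[rotated])
qed

text \<open>The germ of \<open>f\<close> at \<open>p\<close> replaces the prefix of length \<open>n\<close> of \<open>p\<close> by the one of length \<open>n + e\<close>.\<close>

definition germ_shift :: "(bool word \<Rightarrow> bool word) \<Rightarrow> bool word \<Rightarrow> int \<Rightarrow> bool" where
  "germ_shift f p e \<longleftrightarrow> (\<forall>\<^sub>F n in sequentially. 0 \<le> int n + e \<and>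
     (\<forall>x. f (prefix n p \<frown> x) = prefix (nat (int n + e)) p \<frown> x))"

text \<open>Both the replaced word \<open>w\<close> and its replacement \<open>u\<close> are
  prefixes of the fixed point, so longer prefixes of \<open>p\<close> go to prefixes of
  \<open>p\<close>, displaced by the difference of the two lengths.\<close>

lemma thompson_V_germ_shift:
  assumes f: "f \<in> carrier thompson_V" and fp: "f p = p"
  obtains e where "germ_shift f p e"
proof -
  obtain w u y where p: "p = w \<frown> y" and wu: "\<And>x. f (w \<frown> x) = u \<frown> x"
    by (rule thompson_V_local[OF f, of p]) (rule that)
  have "f p = u \<frown> y" unfolding p by (rule wu)
  then have pu: "p = u \<frown> y" unfolding fp .
  have "0 \<le> int n + (int (length u) - int (length w)) \<and>
     (\<forall>x. f (prefix n p \<frown> x) = prefix (nat (int n + (int (length u) - int (length w)))) p \<frown> x)"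
    if n: "n \<ge> length w" for n
  proof -
    have 1: "nat (int n + (int (length u) - int (length w))) = length u + (n - length w)"
      using n by simp
    have 2: "prefix n p = w @ prefix (n - length w) y" using n unfolding p by simp
    have 3: "prefix (length u + (n - length w)) p = u @ prefix (n - length w) y" unfolding pu by simp
    have "f (prefix n p \<frown> x) = u \<frown> (prefix (n - length w) y \<frown> x)" for x
      unfolding 2 using wu[of "prefix (n - length w) y \<frown> x"] by simp
    with n show ?thesis unfolding 1 3 by simp
  qed
  then show ?thesis using that[of "int (length u) - int (length w)"]
    unfolding germ_shift_def eventually_sequentially by blast
qed

lemma germ_shift_id: "germ_shift id p 0"
  by (simp add: germ_shift_def)

lemma germ_shift_comp:
  assumes f: "germ_shift f p d" and g: "germ_shift g p e"
  shows "germ_shift (f \<circ> g) p (d + e)"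
proof -
  obtain M where M: "\<And>n. n \<ge> M \<Longrightarrow> 0 \<le> int n + d \<and>
     (\<forall>x. f (prefix n p \<frown> x) = prefix (nat (int n + d)) p \<frown> x)"
    using f unfolding germ_shift_def eventually_sequentially by blast
  obtain N where N: "\<And>n. n \<ge> N \<Longrightarrow> 0 \<le> int n + e \<and>
     (\<forall>x. g (prefix n p \<frown> x) = prefix (nat (int n + e)) p \<frown> x)"
    using g unfolding germ_shift_def eventually_sequentially by blast
  show ?thesis
    unfolding germ_shift_def eventually_sequentially
  \<comment> \<open>The summand \<open>nat \<bar>e\<bar>\<close> keeps \<open>n + e\<close> beyond
    \<open>M\<close> after \<open>g\<close> has acted.\<close>
  proof (intro exI[of _ "N + M + nat \<bar>e\<bar>"] allI impI)
    fix n assume n: "N + M + nat \<bar>e\<bar> \<le> n"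
    then have "N \<le> n" "M \<le> nat (int n + e)" by linarith+
    with M[of "nat (int n + e)"] N[of n]
    show "0 \<le> int n + (d + e) \<and>
      (\<forall>x. (f \<circ> g) (prefix n p \<frown> x) = prefix (nat (int n + (d + e))) p \<frown> x)"
      by (simp add: algebra_simps)
  qed
qed

lemma germ_shift_funpow: "germ_shift (f ^^ k) p (int k * e)" if "germ_shift f p e"
proof (induction k)
  case (Suc k)
  then show ?case using germ_shift_comp[OF that Suc] by (simp add: algebra_simps comp_def)
qed (use germ_shift_id[of p] in \<open>simp add: id_def\<close>)

lemma germ_shift_eq:
  assumes "germ_shift f p e" "germ_shift g p e"
  shows "\<forall>\<^sub>F x in nhds p. f x = g x"
proof -
  have "\<forall>\<^sub>F n in sequentially. \<forall>x. f (prefix n p \<frown> x) = g (prefix n p \<frown> x)"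
    using assms unfolding germ_shift_def by eventually_elim auto
  then show ?thesis unfolding eventually_nhds_word_iff eventually_sequentially by blast
qed

lemma fixed_germs_commute:
  assumes "f \<in> carrier thompson_V" "g \<in> carrier thompson_V" "f p = p" "g p = p"
  shows "\<forall>\<^sub>F x in nhds p. f (g x) = g (f x)"
proof -
  obtain d e where "germ_shift f p d" "germ_shift g p e"
    using assms thompson_V_germ_shift by metis
  then have "germ_shift (f \<circ> g) p (d + e)" "germ_shift (g \<circ> f) p (d + e)"
    using germ_shift_comp by (metis add.commute)+
  from germ_shift_eq[OF this] show ?thesis by simp
qed

text \<open>Each germ at a fixed point is recorded by one integer, and two integers are always
  linearly dependent. Writing the relation with two pairs of natural numbers avoids inverses; the
  factor \<open>n\<close> allows passing to powers.\<close>

lemma fixed_germs_commensurable: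
  assumes "f \<in> carrier thompson_V" "g \<in> carrier thompson_V" "f p = p" "g p = p"
  obtains r s r' s' :: nat where "(r, s) \<noteq> (r', s')"
    "\<And>n. \<forall>\<^sub>F x in nhds p. (f ^^ (n * r)) ((g ^^ (n * s)) x) = (f ^^ (n * r')) ((g ^^ (n * s')) x)"
proof -
  obtain d e where de: "germ_shift f p d" "germ_shift g p e"
    using assms thompson_V_germ_shift by metis
  have *: "\<forall>\<^sub>F x in nhds p. (f ^^ (n * r)) ((g ^^ (n * s)) x) = (f ^^ (n * r')) ((g ^^ (n * s')) x)"
    if "int r * d + int s * e = int r' * d + int s' * e" for n r s r' s'
  proof -
    have "int (n * r) * d + int (n * s) * e = int n * (int r * d + int s * e)"
      "int (n * r') * d + int (n * s') * e = int n * (int r' * d + int s' * e)"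
      by (simp_all add: algebra_simps)
    then have "germ_shift (f ^^ (n * r) \<circ> g ^^ (n * s)) p (int n * (int r * d + int s * e))"
       "germ_shift (f ^^ (n * r') \<circ> g ^^ (n * s')) p (int n * (int r * d + int s * e))"
      using that germ_shift_comp[OF germ_shift_funpow[OF de(1)] germ_shift_funpow[OF de(2)]]
      by metis+
    from germ_shift_eq[OF this] show ?thesis by simp
  qed
  \<comment> \<open>The signs of \<open>d\<close> and \<open>e\<close> decide on which side of the
    relation \<open>\<bar>e\<bar>\<close> and \<open>\<bar>d\<bar>\<close> must stand.\<close>
  consider "d = 0" | "d \<noteq> 0" "0 \<le> d * e" | "d \<noteq> 0" "d * e < 0" by linarith
  then show ?thesis
  proof cases
    case 1
    show ?thesis by (rule that[of 1 0 0 0], simp, rule *) (simp add: 1)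
  next
    case 2
    have "int (nat \<bar>e\<bar>) * d = int (nat \<bar>d\<bar>) * e" using 2 by (auto simp: abs_if zero_le_mult_iff mult.commute)
    with 2 show ?thesis by (intro that[of "nat \<bar>e\<bar>" 0 0 "nat \<bar>d\<bar>"] *) auto
  next
    case 3
    have "int (nat \<bar>e\<bar>) * d + int (nat \<bar>d\<bar>) * e = 0" using 3 by (auto simp: abs_if mult_less_0_iff mult.commute)
    with 3 show ?thesis by (intro that[of "nat \<bar>e\<bar>" "nat \<bar>d\<bar>" 0 0] *) auto
  qed
qed

section \<open>Powers that insert or delete a repeated word\<close>

lemma concat_replicate_iter:
  "z \<noteq> [] \<Longrightarrow> concat (replicate j z) \<frown> z\<^sup>\<omega> = z\<^sup>\<omega>"
proof (induction j)
  case (Suc j)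
  then show ?case by (metis conc_conc concat.simps(2) iter_unroll length_greater_0_conv replicate_Suc)
qed simp

lemma length_concat_replicate: "length (concat (replicate j z)) = j * length z"
  by (induction j) auto

lemma funpow_prepend:
  assumes "\<And>x. (h ^^ k) (p \<frown> x) = (p @ z) \<frown> x"
  shows "(h ^^ (j * k)) (p \<frown> x) = (p @ concat (replicate j z)) \<frown> x"
proof (induction j arbitrary: x)
  case (Suc j)
  have "(h ^^ (Suc j * k)) (p \<frown> x) = (h ^^ (j * k)) ((h ^^ k) (p \<frown> x))"
    by (simp add: funpow_add add.commute[of k])
  also have "\<dots> = (p @ concat (replicate j z)) \<frown> (z \<frown> x)"
    using assms Suc[of "z \<frown> x"] by simp
  also have "\<dots> = (p @ concat (replicate (Suc j) z)) \<frown> x"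
    by (metis append.assoc conc_conc concat.simps concat_append replicate_Suc replicate_append_same append_Nil2)
  finally show ?case .
qed simp

lemma funpow_cancel_word:
  assumes "\<And>x. (h ^^ k) ((s @ z) \<frown> x) = s \<frown> x"
  shows "(h ^^ (j * k)) ((s @ concat (replicate j z)) \<frown> x) = s \<frown> x"
proof (induction j)
  case (Suc j)
  have "(h ^^ (Suc j * k)) ((s @ concat (replicate (Suc j) z)) \<frown> x)
     = (h ^^ (j * k)) ((h ^^ k) ((s @ z) \<frown> (concat (replicate j z) \<frown> x)))"
    by (simp add: funpow_add add.commute[of k])
  also have "\<dots> = s \<frown> x" using assms[of "concat (replicate j z) \<frown> x"] Suc by simp
  finally show ?case .
qed simp

section \<open>Orbits of aperiodic points\<close>

lemma aperiodic_orbit_inj: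
  assumes h: "inj h" and aper: "\<And>k. 1 \<le> k \<Longrightarrow> (h ^^ k) p \<noteq> p" and eq: "(h ^^ m) p = (h ^^ n) p"
  shows "m = n"
proof -
  have *: False if "i < j" "(h ^^ i) p = (h ^^ j) p" for i j
  proof -
    have "(h ^^ j) p = (h ^^ i) ((h ^^ (j - i)) p)"
      using that(1) by (metis add_diff_inverse_nat comp_apply funpow_add less_imp_not_less)
    then have "p = (h ^^ (j - i)) p"
      using that(2) inj_fn[OF h, of i] by (auto dest: injD)
    moreover have "1 \<le> j - i" using that(1) by simp
    ultimately show False using aper by metis
  qed
  from *[of m n] *[of n m] eq show ?thesis by (metis linorder_neqE_nat)
qed

text \<open>The image of a shrinking cylinder around \<open>\<kappa>\<close> is followed along the
  orbit. If the cylinder is refined only to a bounded depth, the orbit is attracted to a cycle; if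
  it is refined without bound, \<open>\<kappa>\<close> turns out to be periodic, against
  \<open>aper\<close>.\<close>

lemma aperiodic_orbit_converges:
  assumes h: "h \<in> carrier thompson_V" and aper: "\<And>k. 1 \<le> k \<Longrightarrow> (h ^^ k) \<kappa> \<noteq> \<kappa>"
  obtains n k q where "1 \<le> k" "(h ^^ k) q = q" "(\<lambda>j. (h ^^ (n + j * k)) \<kappa>) \<longlonglongrightarrow> q"
proof -
  obtain N H where H: "\<And>w x. N \<le> length w \<Longrightarrow> h (w \<frown> x) = H w \<frown> x"
    using thompson_V_level[OF h] by blast
  have H_append: "H (v @ r) = H v @ r" if "N \<le> length v" for v r
  proof (rule conc_eq_imp_eq)
    fix x show "H (v @ r) \<frown> x = (H v @ r) \<frown> x"
      using H[of "v @ r" x] H[of v "r \<frown> x"] that by simp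
  qed
  note inj = inj_fn[OF thompson_V_inj[OF h]]
  have orbit_inj: "m = n" if "(h ^^ m) \<kappa> = (h ^^ n) \<kappa>" for m n
    by (rule aperiodic_orbit_inj[OF thompson_V_inj[OF h] aper that])
  have split: "(h ^^ j) x = (h ^^ (j - i)) ((h ^^ i) x)" if "i \<le> j" for i j x
    using that by (metis comp_apply funpow_add le_add_diff_inverse2)

  \<comment> \<open>\<open>u n\<close> is the image of a cylinder around \<open>\<kappa>\<close> under \<open>h ^^ n\<close>; the cylinder, of depth \<open>d n\<close>, is
    refined only as far as needed to keep the length of \<open>u n\<close> at least \<open>N\<close>.\<close>
  define s where "s = rec_nat (N, prefix N \<kappa>)
    (\<lambda>_ (d, u). (d + (N - length (H u)), H u @ \<kappa> [d \<rightarrow> d + (N - length (H u))]))"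
  define d where "d n = fst (s n)" for n
  define u where "u n = snd (s n)" for n
  have s0: "d 0 = N" "u 0 = prefix N \<kappa>" by (simp_all add: d_def u_def s_def)
  have dS: "d (Suc n) = d n + (N - length (H (u n)))" for n
    by (simp add: d_def u_def s_def split_beta)
  have uS: "u (Suc n) = H (u n) @ \<kappa> [d n \<rightarrow> d (Suc n)]" for n
    unfolding dS by (simp add: d_def u_def s_def split_beta)
  have len: "N \<le> length (u n)" for n
    by (induction n) (auto simp: s0 uS dS)
  have d_mono: "d m \<le> d n" if "m \<le> n" for m n
    using that by (rule lift_Suc_mono_le[of d, rotated]) (simp add: dS)
  have map: "(h ^^ n) (prefix (d n) \<kappa> \<frown> x) = u n \<frown> x" for n x
  proof (induction n arbitrary: x)
    case (Suc n)
    have "prefix (d (Suc n)) \<kappa> = prefix (d n) \<kappa> @ \<kappa> [d n \<rightarrow> d (Suc n)]"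
      unfolding dS by (rule subsequence_append)
    then show ?case
      using Suc[of "\<kappa> [d n \<rightarrow> d (Suc n)] \<frown> x"] H[of "u n @ \<kappa> [d n \<rightarrow> d (Suc n)]" x] H_append[OF len[of n]] len[of n]
      by (simp add: uS)
  qed (simp add: s0)
  have orbit: "(h ^^ n) \<kappa> = u n \<frown> suffix (d n) \<kappa>" for n
    using map[of n "suffix (d n) \<kappa>"] by simp

  show ?thesis
  proof (cases "\<exists>D. \<forall>n. d n \<le> D")
    case True
    then have fin: "finite (range d)" by (auto simp: finite_nat_set_iff_bounded_le)
    then have "Max (range d) \<in> range d" by (intro Max_in) auto
    then obtain n1 where n1: "d n1 = Max (range d)" by auto
    \<comment> \<open>From \<open>n1\<close> on there is no further refinement, so the words evolve
      by \<open>H\<close> alone and determine the time.\<close>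
    have d_const: "d n = d n1" if "n \<ge> n1" for n
      using d_mono[OF that] fin by (auto simp: n1 intro!: antisym)
    have uS': "u (Suc n) = H (u n)" if "n \<ge> n1" for n
      using uS[of n] d_const[of n] d_const[of "Suc n"] that by simp
    have u_inj: "inj_on u {n1..}"
    proof (rule inj_onI)
      fix m n assume "m \<in> {n1..}" "n \<in> {n1..}" "u m = u n"
      then have "d m = d n" using d_const[of m] d_const[of n] by (metis atLeast_iff)
      then have "(h ^^ m) \<kappa> = (h ^^ n) \<kappa>" unfolding orbit \<open>u m = u n\<close> by (rule arg_cong)
      then show "m = n" by (rule orbit_inj)
    qed
    \<comment> \<open>Only finitely many words are short and none recurs, so the lengths of
      \<open>u n\<close> tend to infinity.\<close>
    have fin_short: "finite {n. n1 \<le> n \<and> length (u n) \<le> L}" for L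
    proof (rule finite_imageD)
      show "finite (u ` {n. n1 \<le> n \<and> length (u n) \<le> L})"
        by (rule finite_subset[OF _ finite_words_length_le[of L]]) auto
      show "inj_on u {n. n1 \<le> n \<and> length (u n) \<le> L}"
        by (rule inj_on_subset[OF u_inj]) auto
    qed
    \<comment> \<open>After a time in \<open>R\<close> only the first \<open>N\<close> letters are ever rewritten. Two such times
      with the same first \<open>N\<close> letters yield a power of \<open>h\<close> that contracts a cylinder into itself.\<close>
    define R where "R = {n. n1 \<le> n \<and> (\<forall>j>n. length (u n) < length (u j))}"
    have "\<exists>n\<ge>m. n \<in> R" for m
    proof -
      define M where "M = max m n1"
      \<comment> \<open>The last time at which the minimal length beyond \<open>M\<close> is
        attained lies in \<open>R\<close>.\<close>
      define L where "L = (LEAST l. \<exists>j\<ge>M. length (u j) = l)"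
      have ex: "\<exists>j\<ge>M. length (u j) = L"
        unfolding L_def by (rule LeastI[of _ "length (u M)"]) auto
      have least: "L \<le> length (u j)" if "M \<le> j" for j
        unfolding L_def by (rule Least_le) (use that in auto)
      define E where "E = {j. M \<le> j \<and> length (u j) = L}"
      have finE: "finite E" by (rule finite_subset[OF _ fin_short[of L]]) (auto simp: E_def M_def)
      have "Max E \<in> E" using finE ex by (intro Max_in) (auto simp: E_def)
      moreover have "length (u (Max E)) < length (u j)" if "j > Max E" for j
      proof -
        have "j \<notin> E" using Max_ge[OF finE, of j] that by auto
        then show ?thesis using least[of j] that \<open>Max E \<in> E\<close> by (auto simp: E_def)
      qed
      ultimately show ?thesis by (intro exI[of _ "Max E"]) (auto simp: E_def R_def M_def)
    qed
    then have infR: "infinite R" by (auto simp: infinite_nat_iff_unbounded_le)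
    have "finite ((\<lambda>n. take N (u n)) ` R)"
      by (rule finite_subset[OF _ finite_words_length_le[of N]]) auto
    from pigeonhole_infinite[OF infR this]
    obtain n where n: "n \<in> R" "infinite {a \<in> R. take N (u a) = take N (u n)}" by blast
    from n(2) obtain m where m: "m > n" "take N (u m) = take N (u n)"
      by (auto simp: infinite_nat_iff_unbounded)
    define p r where "p = take N (u n)" and "r = drop N (u n)"
    have un: "u n = p @ r" "length p = N" using len[of n] by (auto simp: p_def r_def)
    \<comment> \<open>As \<open>n\<close> is in \<open>R\<close>, the later words stay longer than
      \<open>u n\<close>; so the tail \<open>r\<close> is never reached, and \<open>h\<close>
      rewrites only what grows out of \<open>p\<close>.\<close>
    have claim: "\<exists>v. u (n + i) = v @ r \<and> N \<le> length v \<and> (\<forall>x. (h ^^ i) (p \<frown> x) = v \<frown> x)" for i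
    proof (induction i)
      case 0
      then show ?case using un by simp
    next
      case (Suc i)
      then obtain v where v: "u (n + i) = v @ r" "N \<le> length v" "\<And>x. (h ^^ i) (p \<frown> x) = v \<frown> x"
        by blast
      have u': "u (n + Suc i) = H v @ r"
        using uS'[of "n + i"] n(1) H_append[OF v(2)] by (simp add: v(1) R_def)
      moreover have "length (u n) < length (u (n + Suc i))" using n(1) by (simp add: R_def)
      then have "N \<le> length (H v)" unfolding u' un(1) using un(2) by simp
      moreover have "(h ^^ Suc i) (p \<frown> x) = H v \<frown> x" for x
        using v(3)[of x] H[OF v(2), of x] by simp
      ultimately show ?case by blast
    qed
    define k where "k = m - n"
    have k: "1 \<le> k" "m = n + k" using m(1) by (auto simp: k_def)
    from claim[of k] k obtain v where v: "u m = v @ r" "N \<le> length v" "\<And>x. (h ^^ k) (p \<frown> x) = v \<frown> x"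
      by auto
    define z where "z = drop N v"
    have "take N v = p" using m(2) v(1,2) by (simp add: p_def)
    then have vz: "v = p @ z" unfolding z_def by (metis append_take_drop_id)
    have "length (u n) < length (u m)" using n(1) m(1) by (simp add: R_def)
    then have z: "z \<noteq> []" by (auto simp: un(1) v(1) vz)
    have hk: "(h ^^ k) (p \<frown> x) = (p @ z) \<frown> x" for x using v(3) vz by simp
    \<comment> \<open>Since \<open>h ^^ k\<close> inserts \<open>z\<close> after \<open>p\<close>,
      it fixes \<open>p\<close> followed by \<open>z\<close> for ever and draws the whole cylinder
      of \<open>p\<close> towards this point.\<close>
    define q where "q = p \<frown> z\<^sup>\<omega>"
    have "(h ^^ k) q = q"
      unfolding q_def hk using z iter_unroll[of z] by (metis conc_conc length_greater_0_conv)
    moreover have "(\<lambda>j. (h ^^ (n + j * k)) \<kappa>) \<longlonglongrightarrow> q"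
      unfolding word_limit_iff eventually_sequentially
    proof (intro allI exI impI)
      fix l j :: nat assume j: "l \<le> j"
      define x where "x = r \<frown> suffix (d n) \<kappa>"
      define zj where "zj = p @ concat (replicate j z)"
      have "(h ^^ n) \<kappa> = p \<frown> x" using orbit[of n] by (simp add: un(1) x_def)
      then have 1: "(h ^^ (n + j * k)) \<kappa> = zj \<frown> x"
        using funpow_prepend[where h = h and k = k and p = p and z = z and j = j and x = x] hk split[of n "n + j * k" \<kappa>] by (simp add: zj_def)
      have 2: "q = zj \<frown> z\<^sup>\<omega>"
        unfolding q_def zj_def using concat_replicate_iter[OF z, of j] by (metis conc_conc)
      have "j \<le> length zj" using z by (cases z) (auto simp: zj_def length_concat_replicate)
      then show "prefix l ((h ^^ (n + j * k)) \<kappa>) = prefix l q" unfolding 1 2 using j by simp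
    qed
    ultimately show ?thesis using that k(1) by blast
  next
    case False
    \<comment> \<open>Some word \<open>s\<close> of length \<open>N\<close> recurs with ever deeper cylinders, so powers of \<open>h\<close> delete longer
      and longer prefixes \<open>y\<close> of the tail \<open>\<tau>\<close> after \<open>s\<close>. These powers commute, so any two such \<open>y\<close> have a
      common power; hence \<open>\<tau>\<close> is periodic and so is \<open>\<kappa>\<close>.\<close>
    define S where "S = {n. d n < d (Suc n)}"
    have unbounded: "\<exists>n. l < d n" for l using False by (auto simp: not_le)
    have "\<exists>n\<ge>m. n \<in> S" for m
    proof (rule ccontr)
      assume no: "\<not> ?thesis"
      have "d n = d m" if "n \<ge> m" for n
        using that
      proof (induction n rule: dec_induct)
        case (step n)
        then have "\<not> d n < d (Suc n)" using no by (auto simp: S_def)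
        then have "d (Suc n) = d n" using d_mono[of n "Suc n"] by simp
        with step.IH show ?case by metis
      qed simp
      moreover obtain n where "d m < d n" using unbounded by blast
      moreover have "n \<ge> m" using d_mono[of n m] \<open>d m < d n\<close> by (cases "n \<ge> m") auto
      ultimately show False by (metis less_irrefl)
    qed
    then have infS: "infinite S" by (auto simp: infinite_nat_iff_unbounded_le)
    have lenS: "length (u (Suc n)) = N" if "n \<in> S" for n
      using that by (simp add: S_def uS dS)
    have "finite ((\<lambda>n. u (Suc n)) ` S)"
      by (rule finite_subset[OF _ finite_words_length[of N]]) (use lenS in auto)
    from pigeonhole_infinite[OF infS this]
    obtain a where a: "a \<in> S" "infinite {n \<in> S. u (Suc n) = u (Suc a)}" by blast
    define s n0 d0 \<tau> where "s = u (Suc a)" and "n0 = Suc a" and "d0 = d (Suc a)" and "\<tau> = suffix d0 \<kappa>"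
    have far: "\<exists>i y. 1 \<le> i \<and> max 1 l \<le> length y \<and> y = prefix (length y) \<tau> \<and>
        (\<forall>x. (h ^^ i) ((s @ y) \<frown> x) = s \<frown> x)" for l
    proof -
      obtain m where m: "d0 + max 1 l < d m" using unbounded by blast
      from a(2) obtain n where n: "max m n0 \<le> n" "n \<in> S" "u (Suc n) = s"
        unfolding infinite_nat_iff_unbounded_le s_def by blast
      define i where "i = Suc n - n0"
      have i: "1 \<le> i" "Suc n = i + n0" using n(1) by (auto simp: i_def)
      define y where "y = \<kappa> [d0 \<rightarrow> d (Suc n)]"
      have dn: "d0 + max 1 l < d (Suc n)" using m d_mono[of m "Suc n"] n(1) by simp
      have pre: "prefix (d (Suc n)) \<kappa> = prefix d0 \<kappa> @ y"
        unfolding y_def using dn subsequence_append[of \<kappa> d0 "d (Suc n) - d0"] by simp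
      have "(h ^^ i) ((s @ y) \<frown> x) = s \<frown> x" for x
      proof -
        have "s \<frown> x = (h ^^ Suc n) (prefix (d (Suc n)) \<kappa> \<frown> x)" using map[of "Suc n" x] n(3) by simp
        also have "\<dots> = (h ^^ i) ((h ^^ n0) (prefix d0 \<kappa> \<frown> (y \<frown> x)))"
          unfolding pre unfolding i(2) by (simp add: funpow_add)
        also have "(h ^^ n0) (prefix d0 \<kappa> \<frown> (y \<frown> x)) = s \<frown> (y \<frown> x)"
          using map[of "Suc a" "y \<frown> x"] by (simp only: s_def n0_def d0_def)
        finally show ?thesis by simp
      qed
      moreover have "y = prefix (length y) \<tau>" using dn by (simp add: y_def \<tau>_def)
      moreover have "max 1 l \<le> length y" using dn unfolding y_def subsequence_length by arith
      ultimately show ?thesis using i(1) by blast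
    qed
    obtain i y where y: "1 \<le> i" "1 \<le> length y" "\<And>x. (h ^^ i) ((s @ y) \<frown> x) = s \<frown> x"
      using far[of 1] by auto
    then have y0: "y \<noteq> []" by auto
    have "\<tau> n = (y\<^sup>\<omega>) n" for n
    proof -
      obtain i' y' where y': "1 \<le> i'" "Suc n \<le> length y'" "y' = prefix (length y') \<tau>"
        "\<And>x. (h ^^ i') ((s @ y') \<frown> x) = s \<frown> x"
        using far[of "Suc n"] by auto
      have "(h ^^ (i' * i)) ((s @ concat (replicate i' y)) \<frown> y\<^sup>\<omega>) = s \<frown> y\<^sup>\<omega>"
        by (rule funpow_cancel_word) (rule y(3))
      moreover have "(h ^^ (i * i')) ((s @ concat (replicate i y')) \<frown> y\<^sup>\<omega>) = s \<frown> y\<^sup>\<omega>"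
        by (rule funpow_cancel_word) (rule y'(4))
      ultimately have "(s @ concat (replicate i' y)) \<frown> y\<^sup>\<omega> = (s @ concat (replicate i y')) \<frown> y\<^sup>\<omega>"
        using inj[of "i * i'"] by (metis injD mult.commute)
      then have "concat (replicate i' y) \<frown> y\<^sup>\<omega> = concat (replicate i y') \<frown> y\<^sup>\<omega>"
        by (metis conc_conc same_concat_eq)
      then have "y\<^sup>\<omega> = concat (replicate i y') \<frown> y\<^sup>\<omega>" using concat_replicate_iter[OF y0] by simp
      moreover have "concat (replicate i y') = y' @ concat (replicate (i - 1) y')"
        using y(1) by (cases i) auto
      ultimately have "(y\<^sup>\<omega>) n = (y' \<frown> (concat (replicate (i - 1) y') \<frown> y\<^sup>\<omega>)) n" by (metis conc_conc)
      then have "(y\<^sup>\<omega>) n = y' ! n" using y'(2) by (simp del: conc_conc)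
      also have "\<dots> = prefix (length y') \<tau> ! n" using y'(3) by simp
      finally show ?thesis using y'(2) by simp
    qed
    then have \<tau>: "\<tau> = y\<^sup>\<omega>" by auto
    have n0: "(h ^^ n0) \<kappa> = s \<frown> \<tau>" using orbit[of "Suc a"] by (simp add: s_def n0_def \<tau>_def d0_def)
    have "\<tau> = y \<frown> \<tau>" unfolding \<tau> using y0 by (intro iter_unroll) simp
    then have "s \<frown> \<tau> = (s @ y) \<frown> \<tau>" by (metis conc_conc)
    then have "(h ^^ i) ((h ^^ n0) \<kappa>) = (h ^^ n0) \<kappa>" unfolding n0 using y(3)[of \<tau>] by simp
    then have "(h ^^ (i + n0)) \<kappa> = (h ^^ n0) \<kappa>" by (simp add: funpow_add)
    then have "i + n0 = n0" by (rule orbit_inj)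
    with y(1) show ?thesis by simp
  qed
qed

section \<open>Centralizers\<close>

lemma funpow_fixed: "(f ^^ n) x = x" if "f x = x"
  by (induction n) (auto simp: that)

lemma funpow_fixed_dvd:
  assumes "(f ^^ k) x = x" "k dvd n"
  shows "(f ^^ n) x = x"
proof -
  obtain c where "n = k * c" using assms(2) by blast
  then show ?thesis using funpow_fixed[where f = "f ^^ k" and n = c, OF assms(1)] by (simp add: funpow_mult)
qed

text \<open>Each orbit in \<open>L\<close> is a cycle of length at most \<open>card L\<close>, so
  the factorial of \<open>card L\<close> serves. Independence of \<open>K\<close> from
  \<open>D\<close> matters later, where one exponent is used for infinitely many maps.\<close>

lemma finite_inj_power_id:
  fixes L :: "'a set"
  assumes L: "finite L"
  obtains K :: nat where "1 \<le> K"
    "\<And>D p. inj D \<Longrightarrow> D ` L \<subseteq> L \<Longrightarrow> p \<in> L \<Longrightarrow> (D ^^ K) p = p"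
proof
  show "1 \<le> (fact (card L) :: nat)" by simp
  fix D :: "'a \<Rightarrow> 'a" and p assume D: "inj D" "D ` L \<subseteq> L" "p \<in> L"
  have in_L: "(D ^^ i) p \<in> L" for i by (induction i) (use D in auto)
  have "card ((\<lambda>i. (D ^^ i) p) ` {..card L}) \<le> card L"
    by (rule card_mono[OF L]) (use in_L in auto)
  then have "\<not> inj_on (\<lambda>i. (D ^^ i) p) {..card L}" by (intro pigeonhole) simp
  then obtain i j where ij: "i < j" "j \<le> card L" "(D ^^ i) p = (D ^^ j) p"
    by (auto simp: inj_on_def) (metis linorder_neqE_nat)
  then have "(D ^^ j) p = (D ^^ i) ((D ^^ (j - i)) p)"
    by (metis add_diff_inverse_nat comp_apply funpow_add less_imp_not_less)
  then have "(D ^^ (j - i)) p = p" using ij(3) inj_fn[OF D(1), of i] by (metis injD)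
  moreover have "j - i dvd fact (card L)" using ij by (intro dvd_fact) auto
  ultimately show "(D ^^ fact (card L)) p = p" by (rule funpow_fixed_dvd)
qed

text \<open>Otherwise near every point some power is the identity: this is immediate at periodic
  points, while an aperiodic orbit would enter a neighbourhood on which a power is the identity and
  so become periodic. Compactness then makes \<open>h\<close> torsion.\<close>

lemma essential_power_exists:
  assumes h: "h \<in> carrier thompson_V" and non_torsion: "\<And>e. 1 \<le> e \<Longrightarrow> h ^^ e \<noteq> id"
  obtains e where "1 \<le> e" "essential_fixpoints (h ^^ e) \<noteq> {}"
proof (rule ccontr)
  assume "\<not> thesis"
  with that have none: "q \<notin> essential_fixpoints (h ^^ e)" if "1 \<le> e" for e q
    using \<open>1 \<le> e\<close> by blast
  have loc: "\<exists>k\<ge>1. \<forall>\<^sub>F x in nhds \<kappa>. (h ^^ k) x = x" for \<kappa>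
  proof (cases "\<forall>k\<ge>1. (h ^^ k) \<kappa> \<noteq> \<kappa>")
    case True
    then obtain n k q where k: "1 \<le> k" "(h ^^ k) q = q" "(\<lambda>j. (h ^^ (n + j * k)) \<kappa>) \<longlonglongrightarrow> q"
      using aperiodic_orbit_converges[OF h, of \<kappa>] by metis
    then have "\<forall>\<^sub>F x in nhds q. (h ^^ k) x = x"
      using none[of k q] by (auto simp: essential_fixpoints_def)
    with k(3) have "\<forall>\<^sub>F j in sequentially. (h ^^ k) ((h ^^ (n + j * k)) \<kappa>) = (h ^^ (n + j * k)) \<kappa>"
      unfolding filterlim_iff by blast
    then obtain j where "(h ^^ k) ((h ^^ (n + j * k)) \<kappa>) = (h ^^ (n + j * k)) \<kappa>"
      by (auto simp: eventually_sequentially)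
    then have "(h ^^ (k + (n + j * k))) \<kappa> = (h ^^ (n + j * k)) \<kappa>" by (simp add: funpow_add)
    then have "k + (n + j * k) = n + j * k"
      using aperiodic_orbit_inj[OF thompson_V_inj[OF h]] True by blast
    with k(1) show ?thesis by simp
  next
    case False
    then obtain k where "1 \<le> k" "(h ^^ k) \<kappa> = \<kappa>" by blast
    with none[of k \<kappa>] show ?thesis by (auto simp: essential_fixpoints_def)
  qed
  have "\<exists>N. \<forall>w. N \<le> length w \<longrightarrow> (\<exists>k\<ge>1. \<forall>x. (h ^^ k) (w \<frown> x) = w \<frown> x)"
  proof (rule word_compactness)
    fix \<kappa>
    obtain k where k: "k \<ge> 1" "\<forall>\<^sub>F x in nhds \<kappa>. (h ^^ k) x = x" using loc by blast
    then obtain n where "\<And>x. (h ^^ k) (prefix n \<kappa> \<frown> x) = prefix n \<kappa> \<frown> x"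
      unfolding eventually_nhds_word_iff by blast
    with k(1) show "\<exists>n. \<exists>k\<ge>1. \<forall>x. (h ^^ k) (prefix n \<kappa> \<frown> x) = prefix n \<kappa> \<frown> x" by blast
  next
    fix w v assume "\<exists>k\<ge>1. \<forall>x. (h ^^ k) (w \<frown> x) = w \<frown> x"
    then show "\<exists>k\<ge>1. \<forall>x. (h ^^ k) ((w @ v) \<frown> x) = (w @ v) \<frown> x" by (metis conc_conc)
  qed
  then obtain N k where k: "\<And>w. N \<le> length w \<Longrightarrow> 1 \<le> k w"
    "\<And>w x. N \<le> length w \<Longrightarrow> (h ^^ k w) (w \<frown> x) = w \<frown> x" by metis
  define K where "K = (\<Prod>w\<in>{w. length w = N}. k w)"
  have "(h ^^ K) \<kappa> = \<kappa>" for \<kappa>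
  proof (rule funpow_fixed_dvd)
    show "(h ^^ k (prefix N \<kappa>)) \<kappa> = \<kappa>"
      using k(2)[of "prefix N \<kappa>" "suffix N \<kappa>"] by simp
    show "k (prefix N \<kappa>) dvd K"
      unfolding K_def by (rule dvd_prodI) (auto simp: finite_words_length)
  qed
  then have "h ^^ K = id" by auto
  moreover have "1 \<le> K" unfolding K_def
    using k(1) by (intro prod_ge_1) auto
  ultimately show False using non_torsion by blast
qed

text \<open>Conjugation transports fixedness and triviality of the germ. With \<open>h' = h\<close>
  this shows that the centralizer of \<open>h\<close> preserves its essential fixed points.\<close>

lemma essential_fixpoints_conj:
  assumes u: "u \<in> carrier thompson_V" and conj: "\<And>x. u (h x) = h' (u x)"
    and p: "p \<in> essential_fixpoints h"
  shows "u p \<in> essential_fixpoints h'"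
proof -
  have "h' (u p) = u p" using conj[of p] p by (simp add: essential_fixpoints_def)
  moreover have "\<not> (\<forall>\<^sub>F x in nhds (u p). h' x = x)"
  proof
    assume "\<forall>\<^sub>F x in nhds (u p). h' x = x"
    from thompson_V_eventually[OF u this] have "\<forall>\<^sub>F x in nhds p. h x = x"
      by (rule eventually_mono) (metis conj thompson_V_inv_apply(1)[OF u])
    with p show False by (simp add: essential_fixpoints_def)
  qed
  ultimately show ?thesis by (simp add: essential_fixpoints_def)
qed

lemma inv_into_commute:
  assumes u: "u \<in> carrier thompson_V" and comm: "\<And>x. u (h x) = h (u x)"
  shows "inv_into UNIV u (h x) = h (inv_into UNIV u x)"
  by (metis comm thompson_V_inv_apply[OF u])

lemma funpow_commute:
  assumes "\<And>x. u (h x) = h (u x)"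
  shows "(u ^^ n) (h x) = h ((u ^^ n) x)"
  by (induction n) (auto simp: assms)

text \<open>\<open>f\<close> and \<open>g\<close> only permute the essential fixed points of
  \<open>h\<close>, so their germs there cannot be compared. Correcting each by a copy displaced by
  powers of \<open>t\<close> gives maps that fix these points and whose germs commute;
  \<open>fg\<close> and \<open>gf\<close> let the displaced copies cancel.\<close>

lemma commutator_trivial_near_essential:
  assumes f: "f \<in> carrier thompson_V" and g: "g \<in> carrier thompson_V"
    and t: "t \<in> carrier thompson_V" and h: "h \<in> carrier thompson_V"
    and fh: "\<And>x. f (h x) = h (f x)" and gh: "\<And>x. g (h x) = h (g x)" and th: "\<And>x. t (h x) = h (t x)"
    and fg: "\<And>i x. 1 \<le> i \<Longrightarrow>
      (t ^^ i) (f (inv_into UNIV (t ^^ i) (g x))) = g ((t ^^ i) (f (inv_into UNIV (t ^^ i) x)))"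
    and gf: "\<And>i x. 1 \<le> i \<Longrightarrow>
      (t ^^ i) (g (inv_into UNIV (t ^^ i) (f x))) = f ((t ^^ i) (g (inv_into UNIV (t ^^ i) x)))"
    and p: "p \<in> essential_fixpoints h"
  shows "\<forall>\<^sub>F x in nhds p. f (g (inv_into UNIV f (inv_into UNIV g x))) = x"
proof -
  define E where "E = essential_fixpoints h"
  have E: "u e \<in> E" if "u \<in> carrier thompson_V" "\<And>x. u (h x) = h (u x)" "e \<in> E" for u e
    using essential_fixpoints_conj[of u h h e] that by (simp add: E_def)
  obtain K where K: "1 \<le> K" "\<And>D e. inj D \<Longrightarrow> D ` E \<subseteq> E \<Longrightarrow> e \<in> E \<Longrightarrow> (D ^^ K) e = e"
    using finite_inj_power_id[OF finite_essential_fixpoints[OF h]] unfolding E_def by metis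
  define T where "T = t ^^ K"
  define f' g' T' where "f' = inv_into UNIV f" and "g' = inv_into UNIV g" and "T' = inv_into UNIV T"
  have T: "T \<in> carrier thompson_V" unfolding T_def by (rule thompson_V_funpow[OF t])
  have V': "f' \<in> carrier thompson_V" "g' \<in> carrier thompson_V" "T' \<in> carrier thompson_V"
    unfolding f'_def g'_def T'_def by (intro thompson_V_inv_into f g T)+
  have inv: "f' (f x) = x" "f (f' x) = x" "g' (g x) = x" "g (g' x) = x" "T' (T x) = x" "T (T' x) = x" for x
    using f g T by (simp_all add: f'_def g'_def T'_def)
  have Tfix: "T e = e" if "e \<in> E" for e
    unfolding T_def by (rule K(2)[OF thompson_V_inj[OF t] _ that]) (use E[OF t th] in blast)
  then have T'fix: "T' e = e" if "e \<in> E" for e using inv(5) that by metis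
  have Th: "T (h x) = h (T x)" for x unfolding T_def by (rule funpow_commute[where u = t and h = h, OF th])
  have T'h: "T' (h x) = h (T' x)" for x
    unfolding T'_def by (rule inv_into_commute[where h = h, OF T Th])
  have f'h: "f' (h x) = h (f' x)" and g'h: "g' (h x) = h (g' x)" for x
    unfolding f'_def g'_def by (rule inv_into_commute[where h = h, OF f fh], rule inv_into_commute[where h = h, OF g gh])
  define F where "F = (\<lambda>x. T (f (T' x)))"
  \<comment> \<open>Displacing by \<open>T\<close> twice makes \<open>G\<close> commute with
    \<open>F\<close> as well as with \<open>f\<close>.\<close>
  define G where "G = (\<lambda>x. T (T (g (T' (T' x)))))"
  have FG_V: "F \<in> carrier thompson_V" "G \<in> carrier thompson_V"
    using thompson_V_comp T V' f g unfolding F_def G_def comp_def by (metis, metis)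
  have Fg: "F (g x) = g (F x)" for x
    using fg[OF K(1)] by (simp add: F_def T'_def T_def)
  then have Fg': "F (g' x) = g' (F x)" for x by (metis inv(3,4))
  have TT: "t ^^ (2 * K) = T \<circ> T" by (simp add: T_def mult_2 funpow_add)
  have TT': "inv_into UNIV (T \<circ> T) = T' \<circ> T'"
    unfolding T'_def using o_inv_distrib thompson_V_bij[OF T] by blast
  have Gf: "G (f x) = f (G x)" for x
    using gf[of "2 * K" x] K(1) unfolding TT TT' G_def by simp
  then have Gf': "G (f' x) = f' (G x)" for x by (metis inv(1,2))
  have "T (g (T' (f x))) = f (T (g (T' x)))" for x
    using gf[OF K(1)] by (simp add: T'_def T_def)
  then have FG: "F (G x) = G (F x)" for x unfolding F_def G_def by (simp add: inv)
  \<comment> \<open>\<open>X\<close> and \<open>Y\<close> fix \<open>E\<close> pointwise, so their germs commute; the factors \<open>F\<close> and \<open>G\<close> commute with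
    everything relevant and cancel, leaving the commutation of \<open>f'\<close> and \<open>g'\<close>.\<close>
  define X where "X = f' \<circ> F"
  define Y where "Y = g' \<circ> G"
  define W where "W = F \<circ> G"
  have V: "X \<in> carrier thompson_V" "Y \<in> carrier thompson_V" "W \<in> carrier thompson_V"
    unfolding X_def Y_def W_def using V' FG_V by (simp_all add: thompson_V_comp)
  have Wh: "W (h x) = h (W x)" for x
    by (simp add: W_def F_def G_def Th T'h fh gh)
  \<comment> \<open>\<open>W\<close> remains as a common right factor, so the germs are compared at
    the preimage of \<open>p\<close> under \<open>W\<close> and then transported back.\<close>
  define p0 where "p0 = inv_into UNIV W p"
  have p0: "p0 \<in> E"
    unfolding p0_def by (rule E[OF thompson_V_inv_into[OF V(3)] inv_into_commute[where h = h, OF V(3) Wh]]) (simp add: E_def p)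
  have "X p0 = p0" "Y p0 = p0"
    using p0 E[OF f fh p0] E[OF g gh p0] by (simp_all add: X_def Y_def F_def G_def Tfix T'fix inv)
  from fixed_germs_commute[OF V(1,2) this]
  have "\<forall>\<^sub>F x in nhds (inv_into UNIV W p). f' (g' (W x)) = g' (f' (W x))"
    unfolding p0_def[symmetric]
    by (rule eventually_mono) (simp add: X_def Y_def W_def Fg' Gf' FG)
  from thompson_V_eventually[OF thompson_V_inv_into[OF V(3)] this]
  have "\<forall>\<^sub>F x in nhds p. f' (g' x) = g' (f' x)" using V(3) by simp
  then show ?thesis
    unfolding f'_def[symmetric] g'_def[symmetric] by (rule eventually_mono) (simp add: inv)
qed

section \<open>Incommensurable scalings\<close>

lemma orbit_eventually_near_cycle:
  assumes h: "h \<in> carrier thompson_V" and k: "1 \<le> k"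
    and lim: "(\<lambda>j. (h ^^ (n + j * k)) \<kappa>) \<longlonglongrightarrow> q"
    and Q: "\<And>s. s < k \<Longrightarrow> eventually Q (nhds ((h ^^ s) q))"
  shows "\<forall>\<^sub>F m in sequentially. Q ((h ^^ m) \<kappa>)"
proof -
  have "\<forall>\<^sub>F j in sequentially. Q ((h ^^ s) ((h ^^ (n + j * k)) \<kappa>))" if "s < k" for s
    using lim thompson_V_eventually[OF thompson_V_funpow[OF h] Q[OF that]] unfolding filterlim_iff by blast
  then have "\<forall>\<^sub>F j in sequentially. \<forall>s\<in>{..<k}. Q ((h ^^ s) ((h ^^ (n + j * k)) \<kappa>))"
    by (intro eventually_ball_finite) auto
  then obtain J where J: "\<And>j s. j \<ge> J \<Longrightarrow> s < k \<Longrightarrow> Q ((h ^^ s) ((h ^^ (n + j * k)) \<kappa>))"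
    unfolding eventually_sequentially by blast
  show ?thesis
    unfolding eventually_sequentially
  proof (intro exI allI impI)
    fix m assume m: "n + J * k \<le> m"
    define j s where "j = (m - n) div k" and "s = (m - n) mod k"
    have "m - n = j * k + s" by (simp add: j_def s_def)
    then have "m = s + (n + j * k)" using m by simp
    moreover have "J * k div k \<le> j" unfolding j_def by (rule div_le_mono) (use m in simp)
    then have "J \<le> j" using k by simp
    moreover have "s < k" using k by (simp add: s_def)
    ultimately show "Q ((h ^^ m) \<kappa>)" using J[of j s] by (simp add: funpow_add)
  qed
qed

section \<open>Multiplicative independence of 2 and 3\<close>

lemma power_2_3_inj:
  fixes a b c d :: nat
  assumes eq: "(2::nat) ^ a * 3 ^ b = 2 ^ c * 3 ^ d"
  shows "a = c \<and> b = d"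
proof -
  have le: "a \<le> c" if "(2::nat) ^ a * 3 ^ b = 2 ^ c * 3 ^ d" for a b c d :: nat
  proof -
    have "(2::nat) ^ a dvd 2 ^ c * 3 ^ d" using that by (metis dvd_triv_left)
    moreover have "coprime ((2::nat) ^ a) (3 ^ d)" by simp
    ultimately have "(2::nat) ^ a dvd 2 ^ c" by (simp add: coprime_dvd_mult_left_iff)
    then show ?thesis by (rule power_dvd_imp_le) simp
  qed
  have "a = c" using le[OF eq] le[OF eq[symmetric]] by simp
  with eq show ?thesis by simp
qed

text \<open>Taking powers turns a strict inequality of scales into the gap by a factor 2 that
  separates supports.\<close>

lemma power_doubling:
  fixes X Y :: nat
  assumes "1 \<le> X" "X < Y"
  obtains n where "2 * X ^ n \<le> Y ^ n"
proof -
  have "1 < real Y / real X" using assms by simp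
  then obtain n where "2 < (real Y / real X) ^ n" using real_arch_pow by blast
  then have "2 * real X ^ n < real Y ^ n" using assms by (simp add: field_simps power_divide)
  then have "real (2 * X ^ n) \<le> real (Y ^ n)" by simp
  then show ?thesis using that of_nat_le_iff by blast
qed

lemma funpow_conj_inv:
  assumes u: "u \<in> carrier thompson_V"
  shows "((\<lambda>x. inv_into UNIV u (a (u x))) ^^ K) x = inv_into UNIV u ((a ^^ K) (u x))"
  by (induction K) (auto simp: u)

text \<open>The hypotheses record what the Stein group contributes. \<open>FG\<close> and
  \<open>GF\<close> displace supports for the commutator argument, \<open>apart\<close> separates
  \<open>H\<close>, conjugated across a scale gap, from \<open>F\<close>, \<open>G\<close> and
  \<open>T\<close>, and \<open>swap\<close> says that conjugates of \<open>H\<close> do not see the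
  order of \<open>A\<close> and \<open>B\<close>, which are not assumed to commute.\<close>

proposition no_action_with_incommensurable_scalings:
  fixes F G T A B H :: "bool word \<Rightarrow> bool word" and C :: "nat \<Rightarrow> nat \<Rightarrow> bool word \<Rightarrow> bool word"
  assumes V: "F \<in> carrier thompson_V" "G \<in> carrier thompson_V" "T \<in> carrier thompson_V"
      "A \<in> carrier thompson_V" "B \<in> carrier thompson_V"
    and H_def: "H = (\<lambda>x. F (G (inv_into UNIV F (inv_into UNIV G x))))"
    and C_def: "C = (\<lambda>m n. A ^^ m \<circ> B ^^ n)"
    and FG: "\<And>i x. 1 \<le> i \<Longrightarrow>
      (T ^^ i) (F (inv_into UNIV (T ^^ i) (G x))) = G ((T ^^ i) (F (inv_into UNIV (T ^^ i) x)))"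
    and GF: "\<And>i x. 1 \<le> i \<Longrightarrow>
      (T ^^ i) (G (inv_into UNIV (T ^^ i) (F x))) = F ((T ^^ i) (G (inv_into UNIV (T ^^ i) x)))"
    and non_torsion: "\<And>e. 1 \<le> e \<Longrightarrow> H ^^ e \<noteq> id"
    and swap: "\<And>m n x. C m n (H (inv_into UNIV (C m n) x)) =
      (B ^^ n \<circ> A ^^ m) (H (inv_into UNIV (B ^^ n \<circ> A ^^ m) x))"
    and apart: "\<And>m n m' n' D U x. 2 * (2 ^ m * 3 ^ n) \<le> (2::nat) ^ m' * 3 ^ n' \<Longrightarrow>
      D = inv_into UNIV (C m n) \<circ> C m' n' \<Longrightarrow> U \<in> {F, G, T} \<Longrightarrow>
      U (D (H (inv_into UNIV D x))) = D (H (inv_into UNIV D (U x)))"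
  shows False
proof -
  note funpow_V = thompson_V_funpow
  have HV: "H \<in> carrier thompson_V"
  proof -
    have "H = F \<circ> (G \<circ> (inv_into UNIV F \<circ> inv_into UNIV G))" by (simp add: H_def comp_def)
    then show ?thesis using V by (simp add: thompson_V_comp thompson_V_inv_into)
  qed
  have CV: "C m n \<in> carrier thompson_V" for m n
    unfolding C_def by (intro thompson_V_comp funpow_V V)
  obtain e where e: "1 \<le> e" "essential_fixpoints (H ^^ e) \<noteq> {}"
    using essential_power_exists[OF HV non_torsion] by blast
  define P where "P = essential_fixpoints (H ^^ e)"
  have finP: "finite P" unfolding P_def by (rule finite_essential_fixpoints[OF funpow_V[OF HV]])

  \<comment> \<open>Such a coincidence makes \<open>p\<close> an essential fixed point of a power of
    a conjugate \<open>h\<close> of \<open>H\<close> that commutes with \<open>F\<close>,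
    \<open>G\<close> and \<open>T\<close>; then \<open>H\<close> is trivial near \<open>p\<close>,
    against the choice of \<open>P\<close>.\<close>
  have disjoint: False
    if sep: "2 * (2 ^ m * 3 ^ n) \<le> (2::nat) ^ m' * 3 ^ n'" and p: "p \<in> P" "p' \<in> P"
      and eq: "C m n p = C m' n' p'" for m n m' n' p p'
  proof -
    define D where "D = inv_into UNIV (C m n) \<circ> C m' n'"
    have DV: "D \<in> carrier thompson_V"
      unfolding D_def by (intro thompson_V_comp thompson_V_inv_into CV)
    define h where "h = (\<lambda>x. D (H (inv_into UNIV D x)))"
    have hV: "h \<in> carrier thompson_V"
    proof -
      have "h = D \<circ> (H \<circ> inv_into UNIV D)" by (simp add: h_def comp_def)
      then show ?thesis using DV HV by (simp add: thompson_V_comp thompson_V_inv_into)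
    qed
    have hD: "D (H x) = h (D x)" for x by (simp add: h_def DV)
    have Dh: "D ((H ^^ e) x) = (h ^^ e) (D x)" for x
      by (induction e) (simp_all add: hD)
    have "D p' = p" using eq by (simp add: D_def CV flip: eq)
    then have p_ess: "p \<in> essential_fixpoints (h ^^ e)"
      using essential_fixpoints_conj[OF DV, of "H ^^ e" "h ^^ e" p'] Dh p(2) by (simp add: P_def)
    have comm: "U ((h ^^ e) x) = (h ^^ e) (U x)" if "U \<in> {F, G, T}" for U x
    proof -
      have "h (U x) = U (h x)" for x using apart[OF sep D_def that] by (simp add: h_def)
      then show ?thesis using funpow_commute[where u = h and h = U] by metis
    qed
    have "\<forall>\<^sub>F x in nhds p. H x = x"
      unfolding H_def
    proof (rule commutator_trivial_near_essential[where f = F and g = G and t = T and h = "h ^^ e"])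
      show "h ^^ e \<in> carrier thompson_V" by (rule funpow_V[OF hV])
      show "p \<in> essential_fixpoints (h ^^ e)" by (rule p_ess)
    qed (fact V(1) V(2) V(3) FG GF | rule comm, blast)+
    then have "\<forall>\<^sub>F x in nhds p. (H ^^ e) x = x" by (rule eventually_mono) (rule funpow_fixed)
    with p(1) show False by (simp add: P_def essential_fixpoints_def)
  qed

  \<comment> \<open>Both orders conjugate \<open>H\<close> to the same map, so they differ by an
    element centralizing \<open>H\<close>, and this preserves \<open>P\<close>.\<close>
  have exchange: "\<exists>p'\<in>P. (A ^^ m) ((B ^^ n) p) = (B ^^ n) ((A ^^ m) p')"
    "\<exists>p'\<in>P. (B ^^ n) ((A ^^ m) p) = (A ^^ m) ((B ^^ n) p')" if p: "p \<in> P" for m n p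
  proof -
    define C' where "C' = B ^^ n \<circ> A ^^ m"
    have C'V: "C' \<in> carrier thompson_V"
      unfolding C'_def by (intro thompson_V_comp funpow_V V)
    have sw: "C m n (H (inv_into UNIV (C m n) x)) = C' (H (inv_into UNIV C' x))" for x
      unfolding C'_def by (rule swap)
    have move: "\<exists>p'\<in>P. c p = c' p'" if c: "c \<in> carrier thompson_V" "c' \<in> carrier thompson_V"
        and cc': "\<And>x. c (H (inv_into UNIV c x)) = c' (H (inv_into UNIV c' x))" for c c'
    proof -
      define D where "D = inv_into UNIV c' \<circ> c"
      have DV: "D \<in> carrier thompson_V" unfolding D_def by (intro thompson_V_comp thompson_V_inv_into c)
      have "D (H x) = H (D x)" for x
        using cc'[of "c x"] c by (simp add: D_def)
      then have "(H ^^ e) (D x) = D ((H ^^ e) x)" for x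
        using funpow_commute[where u = H and h = D] by metis
      then have "D p \<in> P"
        using essential_fixpoints_conj[OF DV, of "H ^^ e" "H ^^ e" p] p by (simp add: P_def)
      moreover have "c p = c' (D p)" using c by (simp add: D_def)
      ultimately show ?thesis by blast
    qed
    show "\<exists>p'\<in>P. (A ^^ m) ((B ^^ n) p) = (B ^^ n) ((A ^^ m) p')"
      using move[OF CV C'V sw] by (simp add: C_def C'_def)
    show "\<exists>p'\<in>P. (B ^^ n) ((A ^^ m) p) = (A ^^ m) ((B ^^ n) p')"
      using move[OF C'V CV sw[symmetric]] by (simp add: C_def C'_def)
  qed

  \<comment> \<open>The limit set of the sets \<open>(A ^^ m) ` P\<close> as \<open>m\<close> tends to infinity.\<close>
  define L where "L = {q. \<forall>Q. eventually Q (nhds q) \<longrightarrow> (\<forall>M. \<exists>m\<ge>M. \<exists>p\<in>P. Q ((A ^^ m) p))}"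
  have aperiodic: "(A ^^ k) p \<noteq> p" if "p \<in> P" "1 \<le> k" for p k
  proof
    assume eq: "(A ^^ k) p = p"
    have "(2::nat) ^ 1 \<le> 2 ^ k" using that(2) by (intro power_increasing) auto
    then show False using disjoint[of 0 0 k 0 p p] that(1) eq by (simp add: C_def)
  qed
  then have "\<exists>n k q. 1 \<le> k \<and> (A ^^ k) q = q \<and> (\<lambda>j. (A ^^ (n + j * k)) p) \<longlonglongrightarrow> q" if "p \<in> P" for p
    using aperiodic_orbit_converges[OF V(4), of p] that by metis
  then obtain n k q where nkq: "\<And>p. p \<in> P \<Longrightarrow> 1 \<le> k p"
      "\<And>p. p \<in> P \<Longrightarrow> (\<lambda>j. (A ^^ (n p + j * k p)) p) \<longlonglongrightarrow> q p"
    by metis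
  have finL: "finite L"
  proof -
    \<comment> \<open>These are the finitely many cycles that attract the \<open>A\<close>-orbits of
      \<open>P\<close>; a point outside them has a cylinder that the orbits eventually
      avoid.\<close>
    define Z where "Z = (\<Union>p\<in>P. (\<lambda>s. (A ^^ s) (q p)) ` {..<k p})"
    have finZ: "finite Z" unfolding Z_def using finP by auto
    have "L \<subseteq> Z"
    proof
      fix x assume x: "x \<in> L"
      show "x \<in> Z"
      proof (rule ccontr)
        assume "x \<notin> Z"
        have "\<forall>\<^sub>F l in sequentially. prefix l z \<noteq> prefix l x" if "z \<in> Z" for z
        proof -
          from that \<open>x \<notin> Z\<close> have "z \<noteq> x" by auto
          then obtain i where i: "z i \<noteq> x i" by (auto simp: fun_eq_iff)
          have "prefix l z \<noteq> prefix l x" if "l > i" for l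
          proof
            assume "prefix l z = prefix l x"
            then have "prefix l z ! i = prefix l x ! i" by simp
            with that i show False by simp
          qed
          then show ?thesis unfolding eventually_sequentially by (metis Suc_le_eq)
        qed
        then have "\<forall>\<^sub>F l in sequentially. \<forall>z\<in>Z. prefix l z \<noteq> prefix l x"
          by (intro eventually_ball_finite finZ) auto
        then obtain l where l: "\<And>z. z \<in> Z \<Longrightarrow> prefix l z \<noteq> prefix l x"
          by (auto simp: eventually_sequentially)
        have "\<forall>\<^sub>F m in sequentially. prefix l ((A ^^ m) p) \<noteq> prefix l x" if p: "p \<in> P" for p
        proof (rule orbit_eventually_near_cycle[OF V(4) nkq[OF p]])
          fix s assume "s < k p"
          then have "(A ^^ s) (q p) \<in> Z" using p by (auto simp: Z_def)
          then show "\<forall>\<^sub>F y in nhds ((A ^^ s) (q p)). prefix l y \<noteq> prefix l x"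
            unfolding eventually_nhds_word_iff using l by (intro exI[of _ l]) simp
        qed
        then have "\<forall>\<^sub>F m in sequentially. \<forall>p\<in>P. prefix l ((A ^^ m) p) \<noteq> prefix l x"
          by (intro eventually_ball_finite finP) auto
        then obtain M where "\<And>m p. m \<ge> M \<Longrightarrow> p \<in> P \<Longrightarrow> prefix l ((A ^^ m) p) \<noteq> prefix l x"
          unfolding eventually_sequentially by blast
        moreover have "\<forall>\<^sub>F y in nhds x. prefix l y = prefix l x"
          unfolding eventually_nhds_word_iff by (intro exI[of _ l]) simp
        ultimately show False using x unfolding L_def by blast
      qed
    qed
    then show ?thesis using finZ by (rule finite_subset)
  qed

  obtain p0 where p0: "p0 \<in> P" using e(2) by (auto simp: P_def)
  define q0 where "q0 = q p0"
  have q0: "q0 \<in> L"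
    unfolding L_def
  proof (intro CollectI allI impI)
    fix Q M assume "eventually Q (nhds q0)"
    then have "\<forall>\<^sub>F j in sequentially. Q ((A ^^ (n p0 + j * k p0)) p0)"
      using nkq(2)[OF p0] unfolding filterlim_iff q0_def by blast
    then obtain J where J: "\<And>j. j \<ge> J \<Longrightarrow> Q ((A ^^ (n p0 + j * k p0)) p0)"
      unfolding eventually_sequentially by blast
    have "M + J \<le> (M + J) * k p0" using nkq(1)[OF p0] by simp
    then have "M \<le> n p0 + (M + J) * k p0" by linarith
    then show "\<exists>m\<ge>M. \<exists>p\<in>P. Q ((A ^^ m) p)" using J[of "M + J"] p0 by auto
  qed

  \<comment> \<open>\<open>K\<close> is chosen before the conjugates \<open>D\<close> of
    \<open>A\<close> by \<open>B ^^ i\<close>, so it does not depend on \<open>i\<close>.\<close>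
  obtain K where K: "1 \<le> K" "\<And>D x. inj D \<Longrightarrow> D ` L \<subseteq> L \<Longrightarrow> x \<in> L \<Longrightarrow> (D ^^ K) x = x"
    using finite_inj_power_id[OF finL] by metis
  have A_fix: "(A ^^ K) ((B ^^ i) q0) = (B ^^ i) q0" for i
  proof -
    define u where "u = B ^^ i"
    have u: "u \<in> carrier thompson_V" unfolding u_def by (rule funpow_V[OF V(5)])
    define D where "D = (\<lambda>x. inv_into UNIV u (A (u x)))"
    have DV: "D \<in> carrier thompson_V"
    proof -
      have "D = inv_into UNIV u \<circ> (A \<circ> u)" by (simp add: D_def comp_def)
      then show ?thesis using u V by (simp add: thompson_V_comp thompson_V_inv_into)
    qed
    \<comment> \<open>Two exchanges carry \<open>A\<close> past \<open>u\<close>, so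
      \<open>D\<close> sends the translate of \<open>P\<close> by \<open>A ^^ m\<close> into the one
      by \<open>A ^^ Suc m\<close>.\<close>
    have "D x \<in> L" if x: "x \<in> L" for x
      unfolding L_def
    proof (intro CollectI allI impI)
      fix Q M assume "eventually Q (nhds (D x))"
      from thompson_V_eventually[OF DV this] have "\<forall>\<^sub>F y in nhds x. Q (D y)" .
      then obtain m p where m: "m \<ge> M" "p \<in> P" "Q (D ((A ^^ m) p))"
        using x unfolding L_def by blast
      obtain p' where p': "p' \<in> P" "u ((A ^^ m) p) = (A ^^ m) (u p')"
        using exchange(2)[OF m(2), of i m] by (auto simp: u_def)
      obtain p'' where p'': "p'' \<in> P" "(A ^^ Suc m) (u p') = u ((A ^^ Suc m) p'')"
        using exchange(1)[OF p'(1), of "Suc m" i] by (auto simp: u_def)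
      have "D ((A ^^ m) p) = (A ^^ Suc m) p''"
        using p'(2) p''(2) u by (simp add: D_def)
      with m p''(1) show "\<exists>m\<ge>M. \<exists>p\<in>P. Q ((A ^^ m) p)" by (metis le_SucI)
    qed
    then have "(D ^^ K) q0 = q0" by (intro K(2) thompson_V_inj[OF DV] q0) auto
    then have "inv_into UNIV u ((A ^^ K) (u q0)) = q0"
      unfolding D_def funpow_conj_inv[OF u] .
    then show ?thesis unfolding u_def[symmetric] by (metis thompson_V_inv_apply(2)[OF u])
  qed
  \<comment> \<open>A trivial germ would make \<open>A ^^ K\<close> fix a point
    \<open>(B ^^ i) ((A ^^ m) p)\<close>; after an exchange and cancellation of
    \<open>A ^^ m\<close>, two scales that differ by the factor \<open>2 ^ K\<close> contradict
    \<open>disjoint\<close>.\<close>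
  have ess: "(B ^^ i) q0 \<in> essential_fixpoints (A ^^ K)" for i
  proof -
    have "\<not> (\<forall>\<^sub>F x in nhds ((B ^^ i) q0). (A ^^ K) x = x)"
    proof
      assume "\<forall>\<^sub>F x in nhds ((B ^^ i) q0). (A ^^ K) x = x"
      from thompson_V_eventually[OF funpow_V[OF V(5)] this]
      obtain m p where p: "p \<in> P" "(A ^^ K) ((B ^^ i) ((A ^^ m) p)) = (B ^^ i) ((A ^^ m) p)"
        using q0 unfolding L_def by blast
      obtain p' where p': "p' \<in> P" "(B ^^ i) ((A ^^ m) p) = (A ^^ m) ((B ^^ i) p')"
        using exchange(2)[OF p(1)] by blast
      have "(A ^^ m) ((A ^^ K) ((B ^^ i) p')) = (A ^^ m) ((B ^^ i) p')"
        using p(2) unfolding p'(2) by (metis add.commute comp_apply funpow_add)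
      then have "(A ^^ K) ((B ^^ i) p') = (B ^^ i) p'"
        using thompson_V_inj[OF funpow_V[OF V(4), of m]] by (auto dest: injD)
      moreover have "(2::nat) ^ 1 \<le> 2 ^ K" using K(1) by (intro power_increasing) auto
      ultimately show False using disjoint[of 0 i K i p' p'] p'(1) by (simp add: C_def)
    qed
    with A_fix show ?thesis by (simp add: essential_fixpoints_def)
  qed
  \<comment> \<open>The \<open>B\<close>-orbit of \<open>q0\<close> lies in the finite set of
    essential fixed points of \<open>A ^^ K\<close>, hence it is a cycle.\<close>
  obtain K' where K': "1 \<le> K'" "(B ^^ K') q0 = q0"
  proof (rule ccontr)
    assume "\<not> thesis"
    with that have "(B ^^ j) q0 \<noteq> q0" if "1 \<le> j" for j using \<open>1 \<le> j\<close> by blast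
    then have "inj (\<lambda>i. (B ^^ i) q0)"
      using aperiodic_orbit_inj[OF thompson_V_inj[OF V(5)], of q0] by (meson injI)
    moreover have "finite (range (\<lambda>i. (B ^^ i) q0))"
      by (rule finite_subset[OF _ finite_essential_fixpoints[OF funpow_V[OF V(4), of K]]])
        (use ess in auto)
    ultimately show False by (metis finite_imageD infinite_UNIV_nat)
  qed
  obtain r s r' s' where rs: "(r, s) \<noteq> (r', s')" and near: "\<And>n. \<forall>\<^sub>F x in nhds q0.
      ((A ^^ K) ^^ (n * r)) (((B ^^ K') ^^ (n * s)) x) = ((A ^^ K) ^^ (n * r')) (((B ^^ K') ^^ (n * s')) x)"
    by (rule fixed_germs_commensurable[OF funpow_V[OF V(4)] funpow_V[OF V(5)] A_fix[of 0, simplified] K'(2)])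
      (rule that)
  \<comment> \<open>The germ relation applies to some \<open>(A ^^ m) p\<close> near
    \<open>q0\<close> and makes two translates of \<open>P\<close> meet; passing to the power
    \<open>c\<close> provides the scale gap. The exponents are general so that either side may be
    the larger one.\<close>
  have no: False if less: "(2::nat) ^ (K * r) * 3 ^ (K' * s) < 2 ^ (K * r') * 3 ^ (K' * s')"
    and near: "\<And>n. \<forall>\<^sub>F x in nhds q0.
      ((A ^^ K) ^^ (n * r)) (((B ^^ K') ^^ (n * s)) x) = ((A ^^ K) ^^ (n * r')) (((B ^^ K') ^^ (n * s')) x)"
    for r s r' s'
  proof -
    obtain c where c: "2 * ((2::nat) ^ (K * r) * 3 ^ (K' * s)) ^ c \<le> (2 ^ (K * r') * 3 ^ (K' * s')) ^ c"
      by (rule power_doubling[OF _ less]) auto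
    obtain m p where p: "p \<in> P" "((A ^^ K) ^^ (c * r)) (((B ^^ K') ^^ (c * s)) ((A ^^ m) p)) =
        ((A ^^ K) ^^ (c * r')) (((B ^^ K') ^^ (c * s')) ((A ^^ m) p))"
      using near[of c] q0 unfolding L_def by blast
    have form: "\<exists>p'\<in>P. ((A ^^ K) ^^ (c * r)) (((B ^^ K') ^^ (c * s)) ((A ^^ m) p)) =
        C (K * r * c + m) (K' * s * c) p'" for r s
    proof -
      obtain p' where "p' \<in> P" "(B ^^ (K' * s * c)) ((A ^^ m) p) = (A ^^ m) ((B ^^ (K' * s * c)) p')"
        using exchange(2)[OF p(1)] by blast
      moreover have "(A ^^ K) ^^ (c * r) = A ^^ (K * r * c)" "(B ^^ K') ^^ (c * s) = B ^^ (K' * s * c)"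
        by (simp_all add: funpow_mult ac_simps)
      ultimately show ?thesis by (intro bexI[of _ p']) (simp_all add: C_def funpow_add)
    qed
    obtain p1 where p1: "p1 \<in> P" "((A ^^ K) ^^ (c * r)) (((B ^^ K') ^^ (c * s)) ((A ^^ m) p)) =
        C (K * r * c + m) (K' * s * c) p1" using form by blast
    obtain p2 where p2: "p2 \<in> P" "((A ^^ K) ^^ (c * r')) (((B ^^ K') ^^ (c * s')) ((A ^^ m) p)) =
        C (K * r' * c + m) (K' * s' * c) p2" using form by blast
    have "2 * (2 ^ (K * r * c + m) * 3 ^ (K' * s * c)) =
        (2 * ((2::nat) ^ (K * r) * 3 ^ (K' * s)) ^ c) * 2 ^ m"
      by (simp add: power_add power_mult power_mult_distrib)
    also have "\<dots> \<le> (2 ^ (K * r') * 3 ^ (K' * s')) ^ c * 2 ^ m"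
      by (rule mult_right_mono[OF c]) simp
    also have "\<dots> = 2 ^ (K * r' * c + m) * 3 ^ (K' * s' * c)"
      by (simp add: power_add power_mult power_mult_distrib)
    finally show False
      by (rule disjoint[OF _ p1(1) p2(1)]) (use p(2) p1(2) p2(2) in simp)
  qed
  have "(2::nat) ^ (K * r) * 3 ^ (K' * s) \<noteq> 2 ^ (K * r') * 3 ^ (K' * s')"
  proof
    assume "(2::nat) ^ (K * r) * 3 ^ (K' * s) = 2 ^ (K * r') * 3 ^ (K' * s')"
    from power_2_3_inj[OF this] rs K(1) K'(1) show False by simp
  qed
  then consider "(2::nat) ^ (K * r) * 3 ^ (K' * s) < 2 ^ (K * r') * 3 ^ (K' * s')"
    | "(2::nat) ^ (K * r') * 3 ^ (K' * s') < 2 ^ (K * r) * 3 ^ (K' * s)" by linarith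
  then show False
  proof cases
    case 1
    then show ?thesis using no near by blast
  next
    case 2
    have "\<forall>\<^sub>F x in nhds q0.
      ((A ^^ K) ^^ (n * r')) (((B ^^ K') ^^ (n * s')) x) = ((A ^^ K) ^^ (n * r)) (((B ^^ K') ^^ (n * s)) x)" for n
      using near[of n] by (rule eventually_mono) simp
    with 2 show ?thesis using no by blast
  qed
qed

section \<open>Elements of the Stein group\<close>

text \<open>On \<open>[l, r]\<close> the slopes are \<open>1 / k\<close>, \<open>1\<close> and \<open>k\<close>, in this order.\<close>

definition bump :: "real \<Rightarrow> real \<Rightarrow> real \<Rightarrow> real \<Rightarrow> real" where
  "bump k l r x = min x (max (l + (x - l) / k) (max (x - (r - l) * (1 - 1 / k) / 2) (r - k * (r - x))))"

lemma bump_outside: "x \<le> l \<or> r \<le> x \<Longrightarrow> l < r \<Longrightarrow> k \<in> {2, 3} \<Longrightarrow> bump k l r x = x"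
  by (auto simp: bump_def min_def max_def field_simps)

lemma bump_left: "l \<le> x \<Longrightarrow> x \<le> (l + r) / 2 \<Longrightarrow> k \<in> {2, 3} \<Longrightarrow> bump k l r x = l + (x - l) / k"
  by (auto simp: bump_def min_def max_def field_simps)

lemma bump_middle:
  "(l + r) / 2 \<le> x \<Longrightarrow> x \<le> r - (r - l) / (2 * k) \<Longrightarrow> l < r \<Longrightarrow> k \<in> {2, 3} \<Longrightarrow>
    bump k l r x = x - (r - l) * (1 - 1 / k) / 2"
  by (auto simp: bump_def min_def max_def field_simps)

lemma bump_right:
  "r - (r - l) / (2 * k) \<le> x \<Longrightarrow> x \<le> r \<Longrightarrow> l < r \<Longrightarrow> k \<in> {2, 3} \<Longrightarrow> bump k l r x = r - k * (r - x)"
  by (auto simp: bump_def min_def max_def field_simps)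

lemma bump_le: "bump k l r x \<le> x"
  by (simp add: bump_def)

lemma bump_strict_mono: "x < y \<Longrightarrow> k \<in> {2, 3} \<Longrightarrow> bump k l r x < bump k l r y"
proof -
  assume *: "x < y" "k \<in> {2, 3}"
  have mono: "min a (max b (max c d)) < min a' (max b' (max c' d'))"
    if "a < a'" "b < b'" "c < c'" "d < d'" for a b c d a' b' c' d' :: real
    using that by (simp add: min_def max_def)
  show ?thesis unfolding bump_def by (rule mono) (use * in \<open>auto simp: divide_strict_right_mono\<close>)
qed

lemma bump_continuous: "k \<in> {2, 3} \<Longrightarrow> continuous_on S (bump k l r)"
  unfolding bump_def by (intro continuous_intros) auto

lemma slopes23_memI: "2 \<in> slopes23" "3 \<in> slopes23" "1 / 2 \<in> slopes23" "1 / 3 \<in> slopes23"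
proof -
  have "2 powi 1 * 3 powi 0 \<in> slopes23" "2 powi 0 * 3 powi 1 \<in> slopes23"
    unfolding slopes23_def by blast+
  then show "2 \<in> slopes23" "3 \<in> slopes23" by simp_all
  then show "1 / 2 \<in> slopes23" "1 / 3 \<in> slopes23"
    using slopes23_inverse by (metis inverse_eq_divide)+
qed

definition bump_F23 :: "real \<Rightarrow> real \<Rightarrow> real \<Rightarrow> real \<Rightarrow> real" where
  "bump_F23 k l r = restrict (bump k l r) {0..1}"

lemma bump_F23_apply: "x \<in> {0..1} \<Longrightarrow> bump_F23 k l r x = bump k l r x"
  by (simp add: bump_F23_def)

text \<open>The inner breakpoints arise by division by 2 and by \<open>2 * k\<close>, which
  preserves \<open>Z_inv6\<close> for \<open>k\<close> equal to 2 or 3.\<close>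

lemma piecewise_linear23_bump_F23:
  assumes k: "k \<in> {2, 3}" and lr: "l \<in> Z_inv6" "r \<in> Z_inv6" "l < r"
  shows "piecewise_linear23 (bump_F23 k l r)"
  unfolding piecewise_linear23_def
proof (intro exI conjI allI impI)
  let ?B = "{l, (l + r) / 2, r - (r - l) / (2 * k), r}"
  show "finite ?B" by simp
  have "1 / 2 \<in> Z_inv6" "1 / k \<in> Z_inv6" using slopes23_memI slopes23_subset k by auto
  then have "(l + r) * (1 / 2) \<in> Z_inv6" "r - (r - l) * (1 / 2 * (1 / k)) \<in> Z_inv6"
    using lr by (intro Z_inv6_add Z_inv6_diff Z_inv6_mult; simp)+
  then show "?B \<subseteq> Z_inv6" using lr by simp
  fix a b :: real
  assume ab: "0 \<le> a \<and> a < b \<and> b \<le> 1 \<and> {a<..<b} \<inter> ?B = {}"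
  have eq: "bump_F23 k l r x = bump k l r x" if "x \<in> {a..b}" for x
    using that ab by (intro bump_F23_apply) auto
  have *: "y \<le> a \<or> b \<le> y" if "y \<in> ?B" for y using that ab by (meson disjoint_iff greaterThanLessThan_iff not_le)
  have "l \<le> a \<or> b \<le> l" "(l + r) / 2 \<le> a \<or> b \<le> (l + r) / 2"
    "r - (r - l) / (2 * k) \<le> a \<or> b \<le> r - (r - l) / (2 * k)" "r \<le> a \<or> b \<le> r"
    by (rule *, simp)+
  then consider "b \<le> l \<or> r \<le> a" | "l \<le> a" "b \<le> (l + r) / 2"
    | "(l + r) / 2 \<le> a" "b \<le> r - (r - l) / (2 * k)" | "r - (r - l) / (2 * k) \<le> a" "b \<le> r" by blast
  then show "\<exists>s\<in>slopes23. \<exists>c. \<forall>x\<in>{a..b}. bump_F23 k l r x = s * x + c"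
  proof cases
    case 1
    then have "bump_F23 k l r x = 1 * x + 0" if "x \<in> {a..b}" for x
      using eq[OF that] bump_outside[of x l r k] that k lr by auto
    with slopes23_1 show ?thesis by blast
  next
    case 2
    then have "bump_F23 k l r x = 1 / k * x + (l - l / k)" if "x \<in> {a..b}" for x
      using eq[OF that] bump_left[of l x r k] that k by (auto simp: diff_divide_distrib)
    moreover have "1 / k \<in> slopes23" using k slopes23_memI by auto
    ultimately show ?thesis by blast
  next
    case 3
    then have "bump_F23 k l r x = 1 * x + (- ((r - l) * (1 - 1 / k) / 2))" if "x \<in> {a..b}" for x
      using eq[OF that] bump_middle[of l r x k] that k lr by auto
    with slopes23_1 show ?thesis by blast
  next
    case 4
    then have "bump_F23 k l r x = k * x + (r - k * r)" if "x \<in> {a..b}" for x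
      using eq[OF that] bump_right[of r l k x] that k lr by (auto simp: algebra_simps)
    moreover have "k \<in> slopes23" using k slopes23_memI by auto
    ultimately show ?thesis by blast
  qed
qed

text \<open>Monotonicity, fixed endpoints and the intermediate value theorem give a continuous
  bijection; compactness of the interval makes its inverse continuous.\<close>

lemma bump_F23_carrier:
  assumes k: "k \<in> {2, 3}" and lr: "l \<in> Z_inv6" "r \<in> Z_inv6" "l < r" "0 \<le> l" "r \<le> 1"
  shows "bump_F23 k l r \<in> carrier stein_F23"
proof -
  have ends: "bump k l r 0 = 0" "bump k l r 1 = 1" using bump_outside k lr by auto
  have mono: "strict_mono_on {0..1} (bump_F23 k l r)"
    using bump_strict_mono[OF _ k] by (auto simp: strict_mono_on_def bump_F23_apply)
  have im: "bump_F23 k l r ` {0..1} = {0..1}"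
  proof
    have le: "bump k l r x \<le> bump k l r y" if "x \<le> y" for x y
      using bump_strict_mono[OF _ k, of x y] that by (cases "x = y") (auto intro: less_imp_le)
    have "bump_F23 k l r x \<in> {0..1}" if "x \<in> {0..1}" for x
      using le[of 0 x] le[of x 1] that by (simp add: ends bump_F23_apply)
    then show "bump_F23 k l r ` {0..1} \<subseteq> {0..1}" by blast
    show "{0..1} \<subseteq> bump_F23 k l r ` {0..1}"
    proof
      fix y :: real assume y: "y \<in> {0..1}"
      have "\<exists>x. 0 \<le> x \<and> x \<le> 1 \<and> bump k l r x = y"
        by (rule IVT') (use y ends bump_continuous[OF k] in simp_all)
      then obtain x where "x \<in> {0..1}" "bump k l r x = y" by auto
      then show "y \<in> bump_F23 k l r ` {0..1}" using bump_F23_apply by (metis imageI)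
    qed
  qed
  have "continuous_on {0..1} (bump_F23 k l r)"
    using bump_continuous[OF k, of "{0..1}" l r] by (rule continuous_on_eq) (simp add: bump_F23_apply)
  moreover have inj: "inj_on (bump_F23 k l r) {0..1}" using mono by (rule strict_mono_on_imp_inj_on)
  ultimately obtain g where "homeomorphism {0..1} {0..1} (bump_F23 k l r) g"
    using homeomorphism_compact[OF compact_Icc _ im] by blast
  then have "homeomorphic_map (top_of_set {0..1}) (top_of_set {0..1}) (bump_F23 k l r)"
    unfolding homeomorphic_map_maps homeomorphic_maps_def homeomorphism_def by (intro exI[of _ g]) auto
  with mono piecewise_linear23_bump_F23[OF k lr(1-3)] show ?thesis
    by (simp add: stein_F23_def bump_F23_def)
qed

section \<open>Pointwise calculation in the Stein group\<close>

lemma stein_F23_apply_mem: "f x \<in> {0..1}" if "f \<in> carrier stein_F23" "x \<in> {0..1}"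
  using stein_F23_bij[OF that(1)] that(2) by (auto simp: bij_betw_def)

lemma stein_F23_mult_apply: "(f \<otimes>\<^bsub>stein_F23\<^esub> g) x = g (f x)" if "x \<in> {0..1}"
  using that by (simp add: stein_F23_def compose_def)

lemma stein_F23_one_apply: "\<one>\<^bsub>stein_F23\<^esub> x = x" if "x \<in> {0..1}"
  using that by (simp add: stein_F23_def)

lemma stein_F23_inj: "x = y" if "f \<in> carrier stein_F23" "x \<in> {0..1}" "y \<in> {0..1}" "f x = f y"
  using stein_F23_bij[OF that(1)] that by (auto simp: bij_betw_def dest: inj_onD)

lemma stein_F23_inv_apply:
  assumes f: "f \<in> carrier stein_F23" and x: "x \<in> {0..1}"
  shows "(inv\<^bsub>stein_F23\<^esub> f) (f x) = x" "f ((inv\<^bsub>stein_F23\<^esub> f) x) = x"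
  using stein_F23_mult_apply[OF x, of f "inv\<^bsub>stein_F23\<^esub> f"]
    stein_F23_mult_apply[OF x, of "inv\<^bsub>stein_F23\<^esub> f" f] stein_F23_one_apply[OF x]
    group.r_inv[OF group_stein_F23 f] group.l_inv[OF group_stein_F23 f] by simp_all

lemma stein_F23_pow_apply:
  assumes f: "f \<in> carrier stein_F23" and x: "x \<in> {0..1}"
  shows "(f [^]\<^bsub>stein_F23\<^esub> (n::nat)) x = (f ^^ n) x \<and> (f ^^ n) x \<in> {0..1}"
proof (induction n)
  case 0
  then show ?case using x by (simp add: nat_pow_def stein_F23_one_apply)
next
  case (Suc n)
  then show ?case
    using stein_F23_mult_apply[OF x] stein_F23_apply_mem[OF f]
    by (simp add: monoid.nat_pow_Suc[OF group.is_monoid[OF group_stein_F23]])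
qed

lemma stein_F23_ext:
  assumes "f \<in> carrier stein_F23" "g \<in> carrier stein_F23" "\<And>x. x \<in> {0..1} \<Longrightarrow> f x = g x"
  shows "f = g"
  by (rule extensionalityI[of _ "{0..1}"]) (use assms in \<open>auto simp: stein_F23_def\<close>)

text \<open>Injectivity makes \<open>f\<close> preserve \<open>S\<close> and \<open>g\<close> its
  complement, so along each orbit at most one of the two maps moves anything.\<close>

lemma stein_F23_disjoint_supports_commute:
  assumes f: "f \<in> carrier stein_F23" and g: "g \<in> carrier stein_F23"
    and fS: "\<And>x. x \<in> {0..1} \<Longrightarrow> x \<notin> S \<Longrightarrow> f x = x" and gS: "\<And>x. x \<in> {0..1} \<Longrightarrow> x \<in> S \<Longrightarrow> g x = x"
  shows "f \<otimes>\<^bsub>stein_F23\<^esub> g = g \<otimes>\<^bsub>stein_F23\<^esub> f"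
proof (rule stein_F23_ext)
  fix x :: real assume x: "x \<in> {0..1}"
  note fx = stein_F23_apply_mem[OF f x] and gx = stein_F23_apply_mem[OF g x]
  have "g (f x) = f (g x)"
  proof (cases "x \<in> S")
    case True
    then have "f x \<in> S" using fS[OF fx] stein_F23_inj[OF f fx x] by metis
    then show ?thesis using gS[OF fx] gS[OF x True] by simp
  next
    case False
    then have "g x \<notin> S" using gS[OF gx] stein_F23_inj[OF g gx x] by metis
    then show ?thesis using fS[OF gx] fS[OF x False] by simp
  qed
  then show "(f \<otimes>\<^bsub>stein_F23\<^esub> g) x = (g \<otimes>\<^bsub>stein_F23\<^esub> f) x" using x by (simp add: stein_F23_mult_apply)
qed (simp_all add: f g monoid.m_closed[OF group.is_monoid[OF group_stein_F23]])

section \<open>Nonembedding\<close>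

lemma Z_inv6_dyadic: "of_int a / 2 ^ n \<in> Z_inv6"
proof -
  have "(1 / 2) ^ n \<in> Z_inv6" using slopes23_memI slopes23_subset by (intro Z_inv6_power) auto
  from Z_inv6_mult[OF Z_inv6_of_int[of a] this] show ?thesis by (simp add: power_divide)
qed

text \<open>The left half of the interval is the piece of slope \<open>1 / k\<close>, and division
  by \<open>k\<close> stays inside it.\<close>

lemma bump_F23_funpow_near_0:
  assumes k: "k \<in> {2, 3}" and x: "0 \<le> x" "x \<le> 1 / 2"
  shows "(bump_F23 k 0 1 ^^ m) x = x / k ^ m \<and> x / k ^ m \<in> {0..1 / 2}"
proof (induction m)
  case 0
  then show ?case using x by simp
next
  case (Suc m)
  have "bump_F23 k 0 1 y = y / k \<and> y / k \<in> {0..1 / 2}" if "y \<in> {0..1 / 2}" for y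
    using that k by (subst bump_F23_apply) (auto simp: bump_left)
  from this[of "x / k ^ m"] show ?case using Suc by (simp add: mult.commute)
qed

text \<open>On \<open>[3/8, 7/16]\<close> this bump is the translation by \<open>- 1 / 16\<close>,
  so one step suffices, and later steps never move to the right. The supports of \<open>f\<close>
  and \<open>g\<close> will lie in that interval.\<close>

lemma bump_F23_pushes_left:
  assumes i: "1 \<le> i" and x: "0 \<le> x" "x \<le> 7 / 16"
  shows "(bump_F23 2 (1 / 4) (1 / 2) ^^ i) x \<in> {0..3 / 8}"
  using i
proof (induction i rule: dec_induct)
  let ?t = "bump_F23 2 (1 / 4) (1 / 2)"
  have nonneg: "0 \<le> bump 2 (1 / 4) (1 / 2) y" if "0 \<le> y" for y
  proof -
    have "0 \<le> 1 / 4 + (y - 1 / 4) / 2" using that by (simp add: field_simps)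
    with that show ?thesis by (simp add: bump_def le_max_iff_disj)
  qed
  {
    case base
    have "bump 2 (1 / 4) (1 / 2) x \<le> 3 / 8"
      using x bump_le[of 2 "1 / 4" "1 / 2" x] by (cases "x \<le> 3 / 8") (auto simp: bump_middle)
    then show ?case using nonneg[of x] x by (simp add: bump_F23_apply)
  next
    case (step n)
    then show ?case
      using nonneg bump_le[of 2 "1 / 4" "1 / 2" "(?t ^^ n) x"] by (auto simp: bump_F23_apply)
  }
qed

text \<open>Products act from left to right, so this conjugate has its support moved forward by
  \<open>c\<close>.\<close>

lemma conj_fixes:
  assumes c: "c \<in> carrier stein_F23" and f: "f \<in> carrier stein_F23"
    and S: "\<And>x. x \<in> {0..1} \<Longrightarrow> x \<notin> S \<Longrightarrow> f x = x"
    and x: "x \<in> {0..1}" "x \<notin> c ` (S \<inter> {0..1})"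
  shows "(inv\<^bsub>stein_F23\<^esub> c \<otimes>\<^bsub>stein_F23\<^esub> f \<otimes>\<^bsub>stein_F23\<^esub> c) x = x"
proof -
  define y where "y = (inv\<^bsub>stein_F23\<^esub> c) x"
  have y: "y \<in> {0..1}" "c y = x"
    unfolding y_def using stein_F23_apply_mem[OF group.inv_closed[OF group_stein_F23 c] x(1)]
      stein_F23_inv_apply(2)[OF c x(1)] by auto
  with x(2) have "y \<notin> S" by auto
  with y S[of y] x(1) show ?thesis by (simp add: stein_F23_mult_apply y_def)
qed

theorem corollaryD:
  shows "\<not> (\<exists>\<phi>. \<phi> \<in> hom stein_F23 thompson_V \<and> inj_on \<phi> (carrier stein_F23))"
proof
  assume "\<exists>\<phi>. \<phi> \<in> hom stein_F23 thompson_V \<and> inj_on \<phi> (carrier stein_F23)"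
  then obtain \<phi> where \<phi>: "\<phi> \<in> hom stein_F23 thompson_V" and inj: "inj_on \<phi> (carrier stein_F23)"
    by blast
  interpret S: group stein_F23 by (rule group_stein_F23)
  let ?I = "{0..1::real}"

  \<comment> \<open>Images under \<open>\<phi>\<close> of products, conjugates and disjoint
    supports\<close>
  have V: "\<phi> x \<in> carrier thompson_V" if "x \<in> carrier stein_F23" for x
    using hom_in_carrier[OF \<phi> that] .
  have act_mult: "\<phi> (x \<otimes>\<^bsub>stein_F23\<^esub> y) = \<phi> y \<circ> \<phi> x"
    if "x \<in> carrier stein_F23" "y \<in> carrier stein_F23" for x y
    using hom_mult[OF \<phi> that] by (simp add: thompson_V_def)
  have act_one: "\<phi> \<one>\<^bsub>stein_F23\<^esub> = id"
    using hom_one[OF \<phi> group_stein_F23 group_thompson_V] by (simp add: thompson_V_def)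
  have act_inv: "\<phi> (inv\<^bsub>stein_F23\<^esub> x) = inv_into UNIV (\<phi> x)" if x: "x \<in> carrier stein_F23" for x
  proof
    fix z
    have "\<phi> (inv\<^bsub>stein_F23\<^esub> x) \<circ> \<phi> x = id"
      using act_mult[OF x S.inv_closed[OF x]] act_one S.r_inv[OF x] by simp
    from fun_cong[OF this, of "inv_into UNIV (\<phi> x) z"]
    show "\<phi> (inv\<^bsub>stein_F23\<^esub> x) z = inv_into UNIV (\<phi> x) z" using V[OF x] by simp
  qed
  have act_pow: "\<phi> (x [^]\<^bsub>stein_F23\<^esub> (n::nat)) = \<phi> x ^^ n" if "x \<in> carrier stein_F23" for x n
    using that by (induction n) (simp_all add: act_one act_mult id_def)
  have act_conj: "\<phi> (inv\<^bsub>stein_F23\<^esub> c \<otimes>\<^bsub>stein_F23\<^esub> x \<otimes>\<^bsub>stein_F23\<^esub> c) z = \<phi> c (\<phi> x (inv_into UNIV (\<phi> c) z))"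
    if "c \<in> carrier stein_F23" "x \<in> carrier stein_F23" for c x z
    using that by (simp add: act_mult act_inv)
  have act_commute: "\<phi> x (\<phi> y z) = \<phi> y (\<phi> x z)"
    if "x \<in> carrier stein_F23" "y \<in> carrier stein_F23"
      "\<And>p. p \<in> ?I \<Longrightarrow> p \<notin> S \<Longrightarrow> x p = p" "\<And>p. p \<in> ?I \<Longrightarrow> p \<in> S \<Longrightarrow> y p = p" for x y z S
  proof -
    have "\<phi> (y \<otimes>\<^bsub>stein_F23\<^esub> x) = \<phi> (x \<otimes>\<^bsub>stein_F23\<^esub> y)"
      using stein_F23_disjoint_supports_commute[of x y S] that by metis
    then show ?thesis using that by (auto simp: act_mult dest: fun_cong)
  qed

  have act_conj_commute: "\<phi> c (\<phi> x (inv_into UNIV (\<phi> c) (\<phi> y z))) = \<phi> y (\<phi> c (\<phi> x (inv_into UNIV (\<phi> c) z)))"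
    if c: "c \<in> carrier stein_F23" and x: "x \<in> carrier stein_F23" and y: "y \<in> carrier stein_F23"
      and xS: "\<And>p. p \<in> ?I \<Longrightarrow> p \<notin> S \<Longrightarrow> x p = p"
      and yS: "\<And>p. p \<in> ?I \<Longrightarrow> p \<in> c ` (S \<inter> ?I) \<Longrightarrow> y p = p" for c x y S z
  proof -
    have "inv\<^bsub>stein_F23\<^esub> c \<otimes>\<^bsub>stein_F23\<^esub> x \<otimes>\<^bsub>stein_F23\<^esub> c \<in> carrier stein_F23" using c x by simp
    from act_commute[OF this y, of "c ` (S \<inter> ?I)" z] conj_fixes[OF c x xS, of S] yS
    show ?thesis unfolding act_conj[OF c x] by blast
  qed

  define a b t where "a = bump_F23 2 0 1" and "b = bump_F23 3 0 1" and "t = bump_F23 2 (1 / 4) (1 / 2)"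
  \<comment> \<open>The supports of \<open>f\<close> and \<open>g\<close> overlap, so that their
    commutator can be nontrivial, and lie between \<open>3 / 8\<close> and \<open>7 / 16\<close>,
    where \<open>t\<close> translates by \<open>- 1 / 16\<close>.\<close>
  define f g where "f = bump_F23 2 (24 / 64) (27 / 64)" and "g = bump_F23 2 (25 / 64) (28 / 64)"
  have dyadic: "1 / 4 \<in> Z_inv6" "1 / 2 \<in> Z_inv6" "24 / 64 \<in> Z_inv6" "25 / 64 \<in> Z_inv6"
    "27 / 64 \<in> Z_inv6" "28 / 64 \<in> Z_inv6"
    using Z_inv6_dyadic[of 1 2] Z_inv6_dyadic[of 1 1] Z_inv6_dyadic[of 24 6] Z_inv6_dyadic[of 25 6]
      Z_inv6_dyadic[of 27 6] Z_inv6_dyadic[of 28 6] by simp_all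
  have carr: "a \<in> carrier stein_F23" "b \<in> carrier stein_F23" "t \<in> carrier stein_F23"
    "f \<in> carrier stein_F23" "g \<in> carrier stein_F23"
    unfolding a_def b_def t_def f_def g_def by (rule bump_F23_carrier; (rule dyadic | simp))+
  have f_fix: "f p = p" if "p \<in> ?I" "p \<notin> {24 / 64<..<27 / 64}" for p
    unfolding f_def bump_F23_apply[OF that(1)] by (rule bump_outside) (use that(2) in auto)
  have g_fix: "g p = p" if "p \<in> ?I" "p \<notin> {25 / 64<..<28 / 64}" for p
    unfolding g_def bump_F23_apply[OF that(1)] by (rule bump_outside) (use that(2) in auto)
  have t_fix: "t p = p" if "p \<in> ?I" "p \<notin> {1 / 4<..<1 / 2}" for p
    unfolding t_def bump_F23_apply[OF that(1)] by (rule bump_outside) (use that(2) in auto)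

  define h where "h = inv\<^bsub>stein_F23\<^esub> g \<otimes>\<^bsub>stein_F23\<^esub> inv\<^bsub>stein_F23\<^esub> f \<otimes>\<^bsub>stein_F23\<^esub> g \<otimes>\<^bsub>stein_F23\<^esub> f"
  have h: "h \<in> carrier stein_F23" unfolding h_def using carr by simp
  have h_apply: "h (g (f p)) = f (g p)" if p: "p \<in> ?I" for p
    using p stein_F23_apply_mem[OF carr(4)] stein_F23_apply_mem[OF carr(5)]
    by (simp add: h_def stein_F23_mult_apply stein_F23_inv_apply carr)
  \<comment> \<open>The right end is twice the left end, so division by at least 2 moves this
    interval off itself; it holds the supports of \<open>f\<close>, \<open>g\<close>,
    \<open>t\<close> and \<open>h\<close>.\<close>
  let ?J = "{1 / 4<..<1 / 2::real}"
  have f_J: "f p = p" and g_J: "g p = p" if "p \<in> ?I" "p \<notin> ?J" for p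
    using f_fix[OF that(1)] g_fix[OF that(1)] that(2) by auto
  have h_J: "h p = p" if "p \<in> ?I" "p \<notin> ?J" for p
    using h_apply[OF that(1)] f_J[OF that] g_J[OF that] by simp

  define A B T F G H where "A = \<phi> a" and "B = \<phi> b" and "T = \<phi> t" and "F = \<phi> f" and "G = \<phi> g" and "H = \<phi> h"
  define C where "C = (\<lambda>m n. A ^^ m \<circ> B ^^ n)"
  \<comment> \<open>Powers of \<open>b\<close> come first so that \<open>\<phi>\<close> sends
    \<open>c m n\<close> to \<open>C m n\<close>; \<open>c'\<close> has the other order and agrees
    with \<open>c\<close> on \<open>[0, 1/2]\<close>.\<close>
  define c where "c = (\<lambda>(m::nat) (n::nat). b [^]\<^bsub>stein_F23\<^esub> n \<otimes>\<^bsub>stein_F23\<^esub> a [^]\<^bsub>stein_F23\<^esub> m)"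
  define c' where "c' = (\<lambda>(m::nat) (n::nat). a [^]\<^bsub>stein_F23\<^esub> m \<otimes>\<^bsub>stein_F23\<^esub> b [^]\<^bsub>stein_F23\<^esub> n)"
  have c_carr: "c m n \<in> carrier stein_F23" "c' m n \<in> carrier stein_F23" for m n
    unfolding c_def c'_def using carr by simp_all
  have C_c: "C m n = \<phi> (c m n)" "B ^^ n \<circ> A ^^ m = \<phi> (c' m n)" for m n
    unfolding C_def c_def c'_def A_def B_def using carr by (simp_all add: act_mult act_pow)
  have c_apply: "c m n p = p / (2 ^ m * 3 ^ n)" "c' m n p = p / (2 ^ m * 3 ^ n)"
    if p: "0 \<le> p" "p \<le> 1 / 2" for m n p
  proof -
    have pI: "p \<in> ?I" using p by auto
    have 1: "(b [^]\<^bsub>stein_F23\<^esub> n) y = y / 3 ^ n \<and> y / 3 ^ n \<in> {0..1 / 2}"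
      if "y \<in> {0..1 / 2}" for y and n :: nat
      using stein_F23_pow_apply[OF carr(2), of y n] bump_F23_funpow_near_0[of 3 y n] that by (simp add: b_def)
    have 2: "(a [^]\<^bsub>stein_F23\<^esub> n) y = y / 2 ^ n \<and> y / 2 ^ n \<in> {0..1 / 2}"
      if "y \<in> {0..1 / 2}" for y and n :: nat
      using stein_F23_pow_apply[OF carr(1), of y n] bump_F23_funpow_near_0[of 2 y n] that by (simp add: a_def)
    have "p \<in> {0..1 / 2}" using p by simp
    with 1 2 pI show "c m n p = p / (2 ^ m * 3 ^ n)" "c' m n p = p / (2 ^ m * 3 ^ n)"
      by (simp_all add: c_def c'_def stein_F23_mult_apply mult.commute)
  qed

  show False
  proof (rule no_action_with_incommensurable_scalings[where F = F and G = G and T = T and A = A and B = B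
        and C = C and H = H])
    show "F \<in> carrier thompson_V" "G \<in> carrier thompson_V" "T \<in> carrier thompson_V"
      "A \<in> carrier thompson_V" "B \<in> carrier thompson_V"
      unfolding F_def G_def T_def A_def B_def by (rule V; rule carr)+
    show "H = (\<lambda>x. F (G (inv_into UNIV F (inv_into UNIV G x))))"
      unfolding H_def h_def F_def G_def using carr by (simp add: act_mult act_inv comp_def)
    show "C = (\<lambda>m n. A ^^ m \<circ> B ^^ n)" by (rule C_def)
  next
    fix e :: nat assume e: "1 \<le> e"
    \<comment> \<open>This is the value of \<open>g\<close> at \<open>27 / 64\<close>, the right end
      of the support of \<open>f\<close>. Hence \<open>h\<close> maps it to \<open>f s\<close>,
      which lies to its left, and by monotonicity no positive power of \<open>h\<close> fixes
      it.\<close>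
    define s where "s = (105 / 256 :: real)"
    have s: "s \<in> ?I" by (simp add: s_def)
    have "h s < s"
    proof -
      have "f (27 / 64) = 27 / 64" by (rule f_fix) auto
      moreover have "g (27 / 64) = s" by (simp add: g_def s_def bump_F23_apply bump_def)
      moreover have "f s < s" by (simp add: f_def s_def bump_F23_apply bump_def)
      moreover have "h (g (f (27 / 64))) = f (g (27 / 64))" by (rule h_apply) simp
      ultimately show ?thesis by metis
    qed
    have "(h ^^ n) s \<le> s \<and> (n \<ge> 1 \<longrightarrow> (h ^^ n) s < s)" for n
    proof (induction n)
      case (Suc n)
      have "(h ^^ n) s \<in> ?I" using stein_F23_pow_apply[OF h s] by blast
      then have "\<not> h s < h ((h ^^ n) s)" using stein_F23_less_iff[OF h s, of "(h ^^ n) s"] Suc by auto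
      with \<open>h s < s\<close> show ?case by simp
    qed simp
    with e have "(h [^]\<^bsub>stein_F23\<^esub> e) s \<noteq> \<one>\<^bsub>stein_F23\<^esub> s"
      using stein_F23_pow_apply[OF h s, of e] stein_F23_one_apply[OF s] by (metis less_irrefl)
    then have "h [^]\<^bsub>stein_F23\<^esub> e \<noteq> \<one>\<^bsub>stein_F23\<^esub>" by auto
    then have "\<phi> (h [^]\<^bsub>stein_F23\<^esub> e) \<noteq> \<phi> \<one>\<^bsub>stein_F23\<^esub>"
      using inj h by (metis S.nat_pow_closed S.one_closed inj_onD)
    then show "H ^^ e \<noteq> id" unfolding H_def using act_one act_pow[OF h] by simp
  next
    \<comment> \<open>Both supports lie in \<open>(3/8, 7/16)\<close>, which every positive power of
      \<open>t\<close> carries into a region where \<open>f\<close> and \<open>g\<close> are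
      trivial.\<close>
    have push: "\<phi> (t [^]\<^bsub>stein_F23\<^esub> i) (\<phi> x (inv_into UNIV (\<phi> (t [^]\<^bsub>stein_F23\<^esub> i)) (\<phi> y z)))
        = \<phi> y (\<phi> (t [^]\<^bsub>stein_F23\<^esub> i) (\<phi> x (inv_into UNIV (\<phi> (t [^]\<^bsub>stein_F23\<^esub> i)) z)))"
      if i: "1 \<le> i" and xy: "x \<in> carrier stein_F23" "y \<in> carrier stein_F23"
        and x_fix: "\<And>p. p \<in> ?I \<Longrightarrow> p \<notin> {3 / 8<..<7 / 16} \<Longrightarrow> x p = p"
        and y_fix: "\<And>p. p \<in> ?I \<Longrightarrow> p \<le> 3 / 8 \<Longrightarrow> y p = p" for i :: nat and x y z
    proof -
      let ?T = "t [^]\<^bsub>stein_F23\<^esub> i"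
      have T_carr: "?T \<in> carrier stein_F23" using carr by simp
      have "?T p \<le> 3 / 8" if "p \<in> {3 / 8<..<7 / 16} \<inter> ?I" for p
        using bump_F23_pushes_left[OF i, of p] stein_F23_pow_apply[OF carr(3), of p i] that by (simp add: t_def)
      then have "y p = p" if "p \<in> ?I" "p \<in> ?T ` ({3 / 8<..<7 / 16} \<inter> ?I)" for p
        using y_fix that by blast
      from act_conj_commute[OF T_carr xy x_fix this] show ?thesis .
    qed
    fix i x assume i: "1 \<le> (i::nat)"
    have f_fix': "f p = p" and g_fix': "g p = p" if "p \<in> ?I" "p \<notin> {3 / 8<..<7 / 16}" for p
      using f_fix[OF that(1)] g_fix[OF that(1)] that(2) by auto
    have f_low: "f p = p" and g_low: "g p = p" if "p \<in> ?I" "p \<le> 3 / 8" for p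
      using f_fix[OF that(1)] g_fix[OF that(1)] that(2) by auto
    show "(T ^^ i) (F (inv_into UNIV (T ^^ i) (G x))) = G ((T ^^ i) (F (inv_into UNIV (T ^^ i) x)))"
      using push[OF i carr(4,5) f_fix' g_low] unfolding T_def F_def G_def act_pow[OF carr(3)] .
    show "(T ^^ i) (G (inv_into UNIV (T ^^ i) (F x))) = F ((T ^^ i) (G (inv_into UNIV (T ^^ i) x)))"
      using push[OF i carr(5,4) g_fix' f_low] unfolding T_def F_def G_def act_pow[OF carr(3)] .
  next
    fix m n x
    let ?c = "c m n" and ?c' = "c' m n"
    \<comment> \<open>The two orders of scaling agree on \<open>?J\<close>, so \<open>d\<close> is
      the identity there and commutes with \<open>h\<close>, whose support lies in
      \<open>?J\<close>.\<close>
    define d where "d = ?c \<otimes>\<^bsub>stein_F23\<^esub> inv\<^bsub>stein_F23\<^esub> ?c'"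
    have d: "d \<in> carrier stein_F23" unfolding d_def using c_carr by simp
    have "d p = p" if p: "p \<in> ?I" "p \<in> ?J" for p
    proof -
      have "?c p = ?c' p" using c_apply[of p m n] p(2) by auto
      then show ?thesis using p c_carr by (simp add: d_def stein_F23_mult_apply stein_F23_inv_apply)
    qed
    from act_commute[where S = ?J, OF h d h_J this]
    have dh: "H (\<phi> d z) = \<phi> d (H z)" for z unfolding H_def .
    have \<phi>d: "\<phi> d z = inv_into UNIV (\<phi> ?c') (\<phi> ?c z)" for z
      unfolding d_def using c_carr by (simp add: act_mult act_inv)
    have "\<phi> ?c' (H (\<phi> d (inv_into UNIV (\<phi> ?c) x))) = \<phi> ?c' (\<phi> d (H (inv_into UNIV (\<phi> ?c) x)))"
      by (simp add: dh)
    then show "C m n (H (inv_into UNIV (C m n) x)) = (B ^^ n \<circ> A ^^ m) (H (inv_into UNIV (B ^^ n \<circ> A ^^ m) x))"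
      unfolding C_c using V c_carr by (simp add: \<phi>d)
  next
    fix m n m' n' :: nat and D U x
    assume sep: "2 * (2 ^ m * 3 ^ n) \<le> (2::nat) ^ m' * 3 ^ n'"
      and D: "D = inv_into UNIV (C m n) \<circ> C m' n'" and U: "U \<in> {F, G, T}"
    define d where "d = c m' n' \<otimes>\<^bsub>stein_F23\<^esub> inv\<^bsub>stein_F23\<^esub> (c m n)"
    have d: "d \<in> carrier stein_F23" unfolding d_def using c_carr by simp
    have \<phi>d: "\<phi> d = D" unfolding d_def D C_c using c_carr by (simp add: act_mult act_inv)
    obtain u where u: "U = \<phi> u" "u \<in> carrier stein_F23" "\<And>p. p \<in> ?I \<Longrightarrow> p \<notin> ?J \<Longrightarrow> u p = p"
      using U carr f_J g_J t_fix unfolding F_def G_def T_def by blast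
    \<comment> \<open>If \<open>d p\<close> were in \<open>?J\<close> as well, the exact scalings
      would apply to both points and give \<open>d p \<le> p / 2 < 1 / 4\<close>.\<close>
    have "d p \<notin> ?J" if p: "p \<in> ?J \<inter> ?I" for p
    proof
      assume dp: "d p \<in> ?J"
      have "c m' n' p \<in> ?I" using stein_F23_apply_mem[OF c_carr(1)] p by blast
      then have "c m n (d p) = c m' n' p"
        using p c_carr by (simp add: d_def stein_F23_mult_apply stein_F23_inv_apply)
      then have eq: "d p / (2 ^ m * 3 ^ n) = p / (2 ^ m' * 3 ^ n')"
        using c_apply(1)[of p m' n'] c_apply(1)[of "d p" m n] p dp by simp
      have "real (2 * (2 ^ m * 3 ^ n)) \<le> real (2 ^ m' * 3 ^ n')" using sep of_nat_le_iff by blast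
      then have "2 * (2 ^ m * 3 ^ n) \<le> (2::real) ^ m' * 3 ^ n'" by simp
      then have "p / (2 ^ m' * 3 ^ n') \<le> p / (2 * (2 ^ m * 3 ^ n))"
        using p by (intro divide_left_mono) auto
      also have "\<dots> = p / 2 / (2 ^ m * 3 ^ n)" by simp
      also have "\<dots> < d p / (2 ^ m * 3 ^ n)" using p dp by (intro divide_strict_right_mono) auto
      finally show False using eq by simp
    qed
    then have "u p = p" if "p \<in> ?I" "p \<in> d ` (?J \<inter> ?I)" for p using u(3) that by blast
    from act_conj_commute[where S = ?J and z = x, OF d h u(2) h_J this]
    show "U (D (H (inv_into UNIV D x))) = D (H (inv_into UNIV D (U x)))"
      by (simp add: \<phi>d u(1) H_def)
  qed
qed

end
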